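(* Every forest of order $n$ has at most $\sqrt{3}^{\,n}$ many minimal Roman dominating functions. Moreover, there is an algorithm that, given a forest of order $n$, enumerates all its minimal Roman dominating functions in time $\mathcal{O}^*(\sqrt{3}^{\,n})$, with polynomial delay and using polynomial space.
   Context: A forest is a finite, undirected, simple acyclic graph. For a graph $G=(V,E)$, a function $f\colon V\to\{0,1,2\}$ is a Roman dominating function (rdf) if every vertex $v$ with $f(v)=0$ has a neighbor $u$ with $f(u)=2$. Functions $V\to\{0,1,2\}$ are ordered pointwise: $f\le g$ iff $f(v)\le g(v)$ for all $v$. An rdf $f$ is minimal if there is no rdf $g\neq f$ with $g\le f$. Polynomial delay means the time before the first output, between consecutive outputs, and after the last output is bounded by a polynomial in $n$. The notation $\mathcal{O}^*(\cdot)$ suppresses factors polynomial in $n$. *)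

theory Defs
  imports
    Complex_Main
    "HOL-Library.FuncSet"
    "HOL-Library.Discrete_Functions"
    "HOL-Computational_Algebra.Polynomial"
    "Graph_Theory.Pair_Digraph"
begin

section \<open>Forests and minimal Roman dominating functions\<close>

text \<open>
  A finite simple undirected graph is a \<^locale>\<open>pair_graph\<close>: a finite, loop-free digraph with a
  symmetric arc relation.  Every undirected edge gives rise to a closed walk of length 2, which
  is a \<^const>\<open>pre_digraph.cycle\<close> of the digraph but not a cycle of the undirected graph; the
  cycles of the latter are exactly the directed cycles of length at least 3.
\<close>

definition undirected_forest :: "'a pair_pre_digraph \<Rightarrow> bool" where
  "undirected_forest G \<longleftrightarrow>
     pair_graph G \<and> \<not> (\<exists>p. pre_digraph.cycle (with_proj G) p \<and> 3 \<le> length p)"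

definition rdf :: "'a pair_pre_digraph \<Rightarrow> ('a \<Rightarrow> nat) \<Rightarrow> bool" where
  "rdf G f \<longleftrightarrow>
     f \<in> pverts G \<rightarrow>\<^sub>E {0, 1, 2} \<and>
     (\<forall>v \<in> pverts G. f v = 0 \<longrightarrow> (\<exists>u \<in> pverts G. (v, u) \<in> parcs G \<and> f u = 2))"

definition minimal_rdf :: "'a pair_pre_digraph \<Rightarrow> ('a \<Rightarrow> nat) \<Rightarrow> bool" where
  "minimal_rdf G f \<longleftrightarrow>
     rdf G f \<and> \<not> (\<exists>g. rdf G g \<and> g \<noteq> f \<and> (\<forall>v \<in> pverts G. g v \<le> f v))"

definition minimal_rdfs :: "'a pair_pre_digraph \<Rightarrow> ('a \<Rightarrow> nat) set" where
  "minimal_rdfs G = {f. minimal_rdf G f}"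


section \<open>The machine model\<close>

text \<open>
  Algorithms are programs of a structured random access machine.  The memory consists of arrays
  of natural numbers, and a scalar variable is cell 0 of an array.  A program mentions only
  finitely many array names and there is no recursion, so the memory contents and a program
  point from a fixed finite set make up the whole configuration.
\<close>

type_synonym state = "string \<Rightarrow> nat \<Rightarrow> nat"

datatype aexp = Const nat | Cell string aexp | Add aexp aexp | Sub aexp aexp

datatype bexp = Less aexp aexp | Eq aexp aexp | Not bexp | And bexp bexp

datatype com =
    Skip
  | Assign string aexp aexp      \<comment> \<open>\<open>Assign x i e\<close> is \<open>x[i] := e\<close>\<close>
  | Output string aexp           \<comment> \<open>\<open>Output x e\<close> outputs the list \<open>x[0], \<dots>, x[e-1]\<close>\<close>
  | Seq com com
  | If bexp com com
  | While bexp com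

fun aval :: "aexp \<Rightarrow> state \<Rightarrow> nat" where
  "aval (Const k) s = k"
| "aval (Cell x a) s = s x (aval a s)"
| "aval (Add a b) s = aval a s + aval b s"
| "aval (Sub a b) s = aval a s - aval b s"

fun bval :: "bexp \<Rightarrow> state \<Rightarrow> bool" where
  "bval (Less a b) s \<longleftrightarrow> aval a s < aval b s"
| "bval (Eq a b) s \<longleftrightarrow> aval a s = aval b s"
| "bval (Not b) s \<longleftrightarrow> \<not> bval b s"
| "bval (And b c) s \<longleftrightarrow> bval b s \<and> bval c s"

text \<open>
  A trace has one entry per time step: what is output in that step, if anything, and the state
  after it.  An assignment or test takes one step (expressions have a size fixed by the program
  and no multiplication), and an output takes one step for each number written and one for its
  completion.
\<close>

type_synonym trace = "(nat list option \<times> state) list"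

text \<open>
  \<open>exec c s tr t\<close>: started in \<open>s\<close>, the program \<open>c\<close> terminates in \<open>t\<close> with trace \<open>tr\<close>.
\<close>

inductive exec :: "com \<Rightarrow> state \<Rightarrow> trace \<Rightarrow> state \<Rightarrow> bool" where
  Skip: "exec Skip s [(None, s)] s"
| Assign: "s' = s(x := (s x)(aval i s := aval e s)) \<Longrightarrow> exec (Assign x i e) s [(None, s')] s'"
| Output: "exec (Output x e) s
    (replicate (aval e s) (None, s) @ [(Some (map (s x) [0..<aval e s]), s)]) s"
| Seq: "exec c s tr s' \<Longrightarrow> exec d s' tr' s'' \<Longrightarrow> exec (Seq c d) s (tr @ tr') s''"
| IfTrue: "bval b s \<Longrightarrow> exec c s tr s' \<Longrightarrow> exec (If b c d) s ((None, s) # tr) s'"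
| IfFalse: "\<not> bval b s \<Longrightarrow> exec d s tr s' \<Longrightarrow> exec (If b c d) s ((None, s) # tr) s'"
| WhileFalse: "\<not> bval b s \<Longrightarrow> exec (While b c) s [(None, s)] s"
| WhileTrue: "bval b s \<Longrightarrow> exec c s tr s' \<Longrightarrow> exec (While b c) s' tr' s'' \<Longrightarrow>
    exec (While b c) s ((None, s) # tr @ tr') s''"

inductive_cases SkipE: "exec Skip s tr t"
inductive_cases AssignE: "exec (Assign x i e) s tr t"
inductive_cases OutputE: "exec (Output x e) s tr t"
inductive_cases SeqE: "exec (Seq c d) s tr t"
inductive_cases IfE: "exec (If b c d) s tr t"
inductive_cases WhileE: "exec (While b c) s tr t"

lemma exec_deterministic:
  "exec c s tr t \<Longrightarrow> exec c s tr' t' \<Longrightarrow> tr' = tr \<and> t' = t"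
proof (induction arbitrary: tr' t' rule: exec.induct)
  case (Seq c s tr1 s1 d tr2 s2)
  from Seq.prems show ?case by (rule SeqE) (use Seq.IH in blast)
next
  case (IfTrue b s c tr1 s1 d)
  from IfTrue.prems show ?case by (rule IfE) (use IfTrue in blast)+
next
  case (IfFalse b s d tr1 s1 c)
  from IfFalse.prems show ?case by (rule IfE) (use IfFalse in blast)+
next
  case (WhileTrue b s c tr1 s1 tr2 s2)
  from WhileTrue.prems show ?case by (rule WhileE) (use WhileTrue in blast)+
qed (auto elim: SkipE AssignE OutputE WhileE)

fun outputs :: "trace \<Rightarrow> nat list list" where
  "outputs [] = []"
| "outputs ((None, s) # tr) = outputs tr"
| "outputs ((Some xs, s) # tr) = xs # outputs tr"

text \<open>
  \<open>waiting_times 0 tr\<close> lists the number of steps up to the first output, between consecutive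
  outputs, and from the last output to termination.  The first argument counts the steps since
  the last output.
\<close>

fun waiting_times :: "nat \<Rightarrow> trace \<Rightarrow> nat list" where
  "waiting_times k [] = [k]"
| "waiting_times k ((None, s) # tr) = waiting_times (Suc k) tr"
| "waiting_times k ((Some xs, s) # tr) = Suc k # waiting_times 0 tr"

text \<open>
  Space is measured in bits: every nonzero cell is charged for its index and for its contents.
  Since all numbers that occur under a polynomial space bound have polynomially many bits, the
  unit cost of a step is then correct up to a polynomial factor.
\<close>

definition bits :: "nat \<Rightarrow> nat" where
  "bits k = Suc (floor_log k)"

definition support :: "state \<Rightarrow> (string \<times> nat) set" where
  "support s = {(x, i). s x i \<noteq> 0}"

definition space :: "state \<Rightarrow> nat" where
  "space s = (\<Sum>(x, i) \<in> support s. bits i + bits (s x i))"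

text \<open>The sum above always ranges over a finite set when a program starts on a finite input:\<close>

lemma exec_finite_support:
  "exec c s tr t \<Longrightarrow> finite (support s) \<Longrightarrow>
     finite (support t) \<and> (\<forall>s' \<in> snd ` set tr. finite (support s'))"
proof (induction rule: exec.induct)
  case (Assign s' s x i e)
  have "support s' \<subseteq> insert (x, aval i s) (support s)"
    unfolding Assign.hyps support_def by (auto split: if_splits)
  with Assign.prems show ?case
    using finite_subset by auto
qed auto

text \<open>
  On initial state \<open>s\<close>, the program halts after having output each element of \<open>S\<close> exactly once,
  and nothing else, within the given bounds on time, delay and space.
\<close>

definition enumerates_within ::
  "com \<Rightarrow> state \<Rightarrow> nat list set \<Rightarrow> real \<Rightarrow> nat \<Rightarrow> nat \<Rightarrow> bool" where
  "enumerates_within P s S time delay space_bound \<longleftrightarrow>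
     (\<exists>tr t. exec P s tr t \<and>
        distinct (outputs tr) \<and> set (outputs tr) = S \<and>
        real (length tr) \<le> time \<and>
        (\<forall>w \<in> set (waiting_times 0 tr). w \<le> delay) \<and>
        (\<forall>s' \<in> insert s (snd ` set tr). space s' \<le> space_bound))"


section \<open>Input encoding\<close>

text \<open>
  As an input, a graph has the vertices \<open>0, \<dots>, n - 1\<close> and is given by \<open>n\<close> and a list of its
  edges in arbitrary order, in which every edge occurs once, in one of its two orientations.
\<close>

definition edge_list_of :: "nat pair_pre_digraph \<Rightarrow> (nat \<times> nat) list \<Rightarrow> bool" where
  "edge_list_of G es \<longleftrightarrow>
     distinct es \<and> set es \<inter> (set es)\<inverse> = {} \<and> parcs G = set es \<union> (set es)\<inverse>"

definition input_state :: "nat \<Rightarrow> (nat \<times> nat) list \<Rightarrow> state" where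
  "input_state n es = (\<lambda>x i.
     if x = ''n'' \<and> i = 0 then n
     else if x = ''m'' \<and> i = 0 then length es
     else if x = ''src'' \<and> i < length es then fst (es ! i)
     else if x = ''tgt'' \<and> i < length es then snd (es ! i)
     else 0)"

lemma finite_support_input_state: "finite (support (input_state n es))"
proof -
  have "support (input_state n es)
      \<subseteq> {''n'', ''m'', ''src'', ''tgt''} \<times> {..length es}"
    by (auto simp: support_def input_state_def split: if_splits)
  then show ?thesis by (rule finite_subset) simp
qed

text \<open>A function on the vertices is output as the list of its values.\<close>

definition value_list :: "nat \<Rightarrow> (nat \<Rightarrow> nat) \<Rightarrow> nat list" where
  "value_list n f = map f [0..<n]"

end

theory Submission
  imports Defs
begin

text \<open>
  A minimal Roman dominating function \<open>f\<close> is determined by \<open>D = {v. f v = 2}\<close>: it is 0 on the other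
  neighbours of \<open>D\<close> and 1 elsewhere.  The sets that occur are those in which every vertex has an
  external private neighbour, and this property is inherited by subsets.

  Hence the sets can be enumerated in lexicographic order by trying, from the largest vertex
  downwards, to put a vertex into \<open>D\<close> and to drop all larger ones: every partial choice is itself a
  solution, so that the delay is polynomial in every graph.  Only the bound on the number of solutions
  uses that the graph is a forest.

  For this bound, a tree with root \<open>z\<close> is built from single vertices by joining the roots of two
  trees.  The sets in which all vertices except possibly \<open>z\<close> have private neighbours are
  counted in five classes, according to what \<open>z\<close> still needs from, or offers to, a parent.  The
  counts of a joined tree are bilinear in those of its parts.  Except for the trees with one and
  two vertices, they satisfy, after division by \<open>sqrt 3 ^ k\<close>, a system of linear inequalities that
  is preserved by joins and implies the bound.
\<close>

section \<open>The recurrence for rooted trees\<close>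

text \<open>The base \<open>sqrt 3\<close> leaves no room: an edge has 3 = \<open>sqrt 3 ^ 2\<close>
  solutions, so disjoint unions of edges attain the bound. Nor is the total
  \<open>n + d + q + p\<close> inductive by itself, since a join depends on how it is distributed
  among the classes. The way out is a gap: a tree with at least three vertices has at most 0.79
  times the allowed number (the path on three vertices has 4 / (3 * sqrt 3) = 0.770 of it, the path
  on four 7 / 9 = 0.778), and only the two smallest trees stay outside. A join with one of these
  multiplies \<open>R\<close> merely by \<open>sqrt 3\<close> or 3 and may not use up the gap, so
  the totals after such joins enter the system as forms of their own:
  \<open>2 * n + d + q + p + r\<close> for a new vertex and
  \<open>3 * n + 3 * d + 2 * q + 2 * p + r\<close> for a new edge. Their bounds 1.36 and 2.35 lie
  just below 0.79 * sqrt 3 and 0.79 * 3. Both forms are the same for either choice of the new root,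
  because the total does not depend on the root.\<close>

text \<open>
  \<open>k\<close> is the number of vertices.  Of the sets \<open>D\<close>, the number \<open>n\<close> counts those in which the root
  is neither contained nor dominated; \<open>d\<close> those in which it is dominated, but not needed as a
  private neighbour; \<open>q\<close> those in which it is needed as one; \<open>p\<close> those which contain the root
  together with a private neighbour of it; and \<open>r\<close> those in which the root is contained, but still
  lacks a private neighbour.
\<close>

inductive profile :: "nat \<Rightarrow> nat \<Rightarrow> nat \<Rightarrow> nat \<Rightarrow> nat \<Rightarrow> nat \<Rightarrow> bool" where
  leaf: "profile 1 1 0 0 0 1"
| join: "profile k n d q p r \<Longrightarrow> profile k' n' d' q' p' r' \<Longrightarrow>
    profile (k + k') (n * (n' + d' + q')) (n * p' + d * (n' + d' + q' + p'))
      (n * r' + q * (n' + d' + q')) (p * (n' + d' + p') + r * n') (r * (d' + p'))"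

text \<open>
  The inequalities were found by computer: starting from \<open>n + d + q + p \<le> 79 / 100 * R\<close>, they are
  pulled back along the joins with trees of one and two vertices and rounded.  Here \<open>R\<close> stands
  for \<open>sqrt 3 ^ k\<close>.
\<close>

definition admissible :: "real \<Rightarrow> real \<Rightarrow> real \<Rightarrow> real \<Rightarrow> real \<Rightarrow> real \<Rightarrow> bool" where
  "admissible R n d q p r \<longleftrightarrow> 0 \<le> R \<and> 0 \<le> n \<and> 0 \<le> d \<and> 0 \<le> q \<and> 0 \<le> p \<and> 0 \<le> r \<and>
     n + d + q + p \<le> 79 / 100 * R \<and>
     2 * n + d + q + p + r \<le> 136 / 100 * R \<and>
     3 * n + 3 * d + 2 * q + 2 * p + r \<le> 235 / 100 * R \<and>
     p + r \<le> 46 / 100 * R \<and>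
     n \<le> 385 / 1000 * R \<and>
     n + d + q \<le> 2 / 3 * R"

lemma admissible_join:
  assumes "admissible R n d q p r" "admissible R' n' d' q' p' r'"
  shows "admissible (R * R') (n * (n' + d' + q')) (n * p' + d * (n' + d' + q' + p'))
      (n * r' + q * (n' + d' + q')) (p * (n' + d' + p') + r * n') (r * (d' + p'))"
proof -
  \<comment> \<open>With the slacks of the hypotheses, the three largest of the inequalities follow from
    nonnegative combinations of products, which were found by linear programming.\<close>
  define sN sM sG sP sn sA where s:
    "sN = 79 * R - 100 * (n + d + q + p)"
    "sM = 136 * R - 100 * (2 * n + d + q + p + r)"
    "sG = 235 * R - 100 * (3 * n + 3 * d + 2 * q + 2 * p + r)"
    "sP = 46 * R - 100 * (p + r)"
    "sn = 385 * R - 1000 * n"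
    "sA = 2 * R - 3 * (n + d + q)"
  define sN' sM' sG' sP' sn' sA' where s':
    "sN' = 79 * R' - 100 * (n' + d' + q' + p')"
    "sM' = 136 * R' - 100 * (2 * n' + d' + q' + p' + r')"
    "sG' = 235 * R' - 100 * (3 * n' + 3 * d' + 2 * q' + 2 * p' + r')"
    "sP' = 46 * R' - 100 * (p' + r')"
    "sn' = 385 * R' - 1000 * n'"
    "sA' = 2 * R' - 3 * (n' + d' + q')"
  have [simp]: "0 \<le> R" "0 \<le> n" "0 \<le> d" "0 \<le> q" "0 \<le> p" "0 \<le> r"
      "0 \<le> R'" "0 \<le> n'" "0 \<le> d'" "0 \<le> q'" "0 \<le> p'" "0 \<le> r'"
      "0 \<le> sN" "0 \<le> sM" "0 \<le> sG" "0 \<le> sP" "0 \<le> sn" "0 \<le> sA"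
      "0 \<le> sN'" "0 \<le> sM'" "0 \<le> sG'" "0 \<le> sP'" "0 \<le> sn'" "0 \<le> sA'"
    using assms unfolding s s' admissible_def by simp_all
  have "60000000 * (79 * (R * R') - 100 * (n * (n' + d' + q') + (n * p' + d * (n' + d' + q' + p')) + (n * r' + q * (n' + d' + q')) + (p * (n' + d' + p') + r * n'))) =
      1461000 * (q * sn') + 1752000 * (sn * q') + 271500 * (sP * sP')
       + 10950000 * (n * sP') + 13350000 * (n * sM') + 17790000 * (n * sG')
       + 4940000 * (sA * sM') + 21510000 * (sM * n') + 67800 * (sG * sN')
       + 60120000 * (d * sN') + 1779000000 * (q * sA') + 2100000 * (sM * sA')
       + 1582000000 * (sA * q') + 1077000 * (r * sn') + 1020000 * (sA * sG')
       + 41400000 * (sN * p') + 9300000 * (p * sP') + 29190000 * (p * sN')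
       + 20850000 * (sP * p') + 14610000 * (sG * n') + 3447 * (sn * sn')
       + 13140000 * (r * sM') + 50700000 * (sN * d') + 17910000 * (sM * r')
       + 1587425 * (R * R') + 6485000 * (R * n') + 44800000 * (R * d')
       + 7580000 * (R * q') + 8500000 * (R * p') + 5140000 * (R * r')
       + 8625000 * (n * R') + 69000000 * (n * n') + 48000000 * (n * d')
       + 3000000 * (n * q') + 3000000 * (n * r') + 12000000 * (d * R')
       + 18000000 * (d * d') + 24000000 * (d * p') + 3000000 * (d * r')
       + 105375000 * (q * R') + 3000000 * (q * n') + 21000000 * (q * d')
       + 3000000 * (q * q') + 690000000 * (q * p') + 3000000 * (q * r')
       + 6330000 * (p * R') + 6000000 * (p * n') + 3000000 * (p * d')
       + 933000000 * (p * q') + 3000000 * (p * p') + 6000000 * (p * r')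
       + 2835000 * (r * R') + 9000000 * (r * n') + 6000000 * (r * d')
       + 6000000 * (r * q') + 6000000 * (r * p') + 390000000 * (r * r')"
    unfolding s s' by (simp add: algebra_simps)
  also have "\<dots> \<ge> 0"
    by (intro add_nonneg_nonneg mult_nonneg_nonneg) simp_all
  finally have N: "n * (n' + d' + q') + (n * p' + d * (n' + d' + q' + p')) + (n * r' + q * (n' + d' + q')) + (p * (n' + d' + p') + r * n') \<le> 79 / 100 * (R * R')"
    by simp
  have "20000 * (136 * (R * R') - 100 * (2 * (n * (n' + d' + q')) + (n * p' + d * (n' + d' + q' + p')) + (n * r' + q * (n' + d' + q')) + (p * (n' + d' + p') + r * n') + r * (d' + p'))) =
      1730 * (sn * r') + 39 * (sG * sG') + 19300 * (sM * d') + 590000 * (sA * q')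
       + 5800 * (sG * p') + 3800 * (sM * R') + 1640 * (sn * q') + 14900 * (n * sG')
       + 19300 * (sM * n') + 13300 * (d * sG') + 4300 * (r * sG') + 9200 * (q * sG')
       + 8200 * (p * sG') + 8100 * (sP * p') + 5800 * (r * sP') + 49425 * (R * R')
       + 124700 * (R * n') + 124700 * (R * d') + 21600 * (R * q') + 97400 * (R * p')
       + 250450 * (R * r') + 8000 * (n * R') + 820000 * (n * n') + 820000 * (n * d')
       + 50000 * (n * q') + 380000 * (n * p') + 50000 * (n * r') + 4000 * (d * R')
       + 410000 * (d * n') + 410000 * (d * d') + 90000 * (d * q') + 60000 * (d * p')
       + 160000 * (d * r') + 51000 * (q * R') + 350000 * (q * n') + 350000 * (q * d')
       + 50000 * (q * q') + 1440000 * (q * p') + 140000 * (q * r') + 286000 * (p * R')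
       + 50000 * (p * n') + 50000 * (p * d') + 80000 * (p * q') + 50000 * (p * p')
       + 40000 * (p * r') + 19200 * (r * R') + 50000 * (r * n') + 50000 * (r * d')
       + 80000 * (r * q') + 50000 * (r * p') + 620000 * (r * r')"
    unfolding s s' by (simp add: algebra_simps)
  also have "\<dots> \<ge> 0"
    by (intro add_nonneg_nonneg mult_nonneg_nonneg) simp_all
  finally have M: "2 * (n * (n' + d' + q')) + (n * p' + d * (n' + d' + q' + p')) + (n * r' + q * (n' + d' + q')) + (p * (n' + d' + p') + r * n') + r * (d' + p') \<le> 136 / 100 * (R * R')"
    by simp
  have "18000 * (235 * (R * R') - 100 * (3 * (n * (n' + d' + q')) + 3 * (n * p' + d * (n' + d' + q' + p')) + 2 * (n * r' + q * (n' + d' + q')) + 2 * (p * (n' + d' + p') + r * n') + r * (d' + p'))) =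
      17100 * (sP * p') + 24600 * (R * sN') + 1270000 * (sA * q') + 480 * (sn * q')
       + 99 * (sG * sP') + 12600 * (sG * n') + 12600 * (sG * d') + 16200 * (d * sN')
       + 5700 * (n * sG') + 5700 * (R * sP') + 3600 * (q * sG') + 24300 * (sG * p')
       + 228 * (sP * sP') + 42 * (sP * sG') + 7800 * (p * sG') + 9000 * (p * sP')
       + 18000 * (r * sM') + 30300 * (sM * r') + 17742 * (R * R') + 78600 * (R * n')
       + 78600 * (R * d') + 121600 * (R * q') + 294600 * (R * p') + 17700 * (R * r')
       + 26700 * (n * R') + 90000 * (n * n') + 90000 * (n * d') + 30000 * (n * q')
       + 60000 * (n * p') + 60000 * (n * r') + 86400 * (d * R') + 30000 * (d * q')
       + 540000 * (d * p') + 60000 * (d * r') + 64800 * (q * R') + 930000 * (q * q')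
       + 3600000 * (q * p') + 1410000 * (q * r') + 699600 * (p * R') + 720000 * (p * q')
       + 330000 * (p * p') + 30000 * (p * r') + 43200 * (r * R') + 960000 * (r * q')
       + 30000 * (r * p') + 1140000 * (r * r')"
    unfolding s s' by (simp add: algebra_simps)
  also have "\<dots> \<ge> 0"
    by (intro add_nonneg_nonneg mult_nonneg_nonneg) simp_all
  finally have G: "3 * (n * (n' + d' + q')) + 3 * (n * p' + d * (n' + d' + q' + p')) + 2 * (n * r' + q * (n' + d' + q')) + 2 * (p * (n' + d' + p') + r * n') + r * (d' + p') \<le> 235 / 100 * (R * R')"
    by simp
  have b: "n \<le> 385 / 1000 * R" "n + d + q \<le> 2 / 3 * R" "p + r \<le> 46 / 100 * R"
    "n' + d' + q' \<le> 2 / 3 * R'" "p' + r' \<le> 46 / 100 * R'" "n' + d' + q' + p' \<le> 79 / 100 * R'"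
    using assms by (simp_all add: admissible_def)
  have "n * (n' + d' + q') \<le> 385 / 1000 * R * R'"
    by (intro mult_mono b(1) order_trans[OF b(4)]) simp_all
  then have n: "n * (n' + d' + q') \<le> 385 / 1000 * (R * R')"
    by simp
  \<comment> \<open>The new \<open>p + r\<close> factors as \<open>(p + r) * (n' + d' + p')\<close>,
    so it is enough that the second factor is at most \<open>R'\<close>.\<close>
  have "n' + d' + p' \<le> R'"
    using b(6) \<open>0 \<le> q'\<close> \<open>0 \<le> R'\<close> by linarith
  then have "(p + r) * (n' + d' + p') \<le> 46 / 100 * R * R'"
    by (intro mult_mono b(3)) simp_all
  then have pr: "(p * (n' + d' + p') + r * n') + r * (d' + p') \<le> 46 / 100 * (R * R')"
    by (simp add: algebra_simps)
  \<comment> \<open>The new \<open>n + d + q\<close> is grouped by the unprimed variables. The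
    coefficient 169 / 150 is 2 / 3 + 46 / 100; it exceeds 2 / 3, but is paid for by the small bound
    on \<open>n\<close>.\<close>
  have "n * (n' + d' + q' + (p' + r')) \<le> n * (169 / 150 * R')"
    by (rule mult_left_mono) (use b(4,5) in linarith, simp)
  moreover have "d * (n' + d' + q' + p') \<le> d * (79 / 100 * R')"
    by (rule mult_left_mono) (use b(6) in simp_all)
  moreover have "q * (n' + d' + q') \<le> q * (2 / 3 * R')"
    by (rule mult_left_mono) (use b(4) in simp_all)
  moreover have "169 / 150 * n + 79 / 100 * d + 2 / 3 * q \<le> 2 / 3 * R"
    using b(1,2) \<open>0 \<le> q\<close> \<open>0 \<le> R\<close> by linarith
  then have "(169 / 150 * n + 79 / 100 * d + 2 / 3 * q) * R' \<le> 2 / 3 * R * R'"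
    by (rule mult_right_mono) simp
  ultimately have A: "n * (n' + d' + q') + (n * p' + d * (n' + d' + q' + p'))
      + (n * r' + q * (n' + d' + q')) \<le> 2 / 3 * (R * R')"
    unfolding ring_distribs by linarith
  show ?thesis unfolding admissible_def by (intro conjI N M G pr n A) simp_all
qed

lemma sqrt3_bounds: "1732 / 1000 < sqrt 3" "sqrt 3 < 1733 / 1000"
proof -
  show "1732 / 1000 < sqrt 3" by (rule real_less_rsqrt) (simp add: power2_eq_square)
  show "sqrt 3 < 1733 / 1000" by (rule real_less_lsqrt) (simp_all add: power2_eq_square)
qed

text \<open>Joins with a single vertex, first as a child of the root, then as the new root. The
  second join ties the constants together: its new \<open>n\<close> is \<open>n + d + q\<close>, and
  2 / 3 is just below 0.385 * sqrt 3; its new \<open>p + r\<close> is \<open>n + d + p\<close>, and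
  0.79 is just below 0.46 * sqrt 3.\<close>

lemma admissible_scaled_sqrt3:
  assumes "admissible R n d q p r"
  shows "admissible (R * sqrt 3) n d (n + q) (p + r) 0"
    and "admissible (sqrt 3 * R) (n + d + q) p r n (d + p)"
proof -
  have "1732 / 1000 * R \<le> R * sqrt 3"
    using sqrt3_bounds mult_left_mono[of "1732 / 1000" "sqrt 3" R] assms
    unfolding admissible_def by linarith
  moreover have "sqrt 3 * R = R * sqrt 3" by simp
  ultimately show "admissible (R * sqrt 3) n d (n + q) (p + r) 0"
    and "admissible (sqrt 3 * R) (n + d + q) p r n (d + p)"
    using assms unfolding admissible_def by - (elim conjE; intro conjI; argo)+
qed

text \<open>Joins with an edge, whose counts are 1, 0, 1, 1, 0 and whose factor is
  \<open>sqrt 3 ^ 2\<close>, first below the given tree and then above it.\<close>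

lemma admissible_scaled_3:
  assumes "admissible R n d q p r"
  shows "admissible (R * 3) (2 * n) (n + 3 * d) (2 * q) (2 * p + r) r"
    and "admissible (3 * R) (n + d + q) p (n + d + q + r) (n + d + p) 0"
  using assms unfolding admissible_def by - (elim conjE; intro conjI; argo)+

text \<open>The two exceptions are inevitable: a single vertex violates
  \<open>n \<le> 385 / 1000 * R\<close>, and an edge has total 3 = \<open>R\<close>. Two exceptional
  trees join to an edge or to one of three rooted trees that are evaluated directly; every other
  join has an admissible part.\<close>

lemma profile_bound:
  assumes "profile k n d q p r"
  shows "k = 1 \<and> n = 1 \<and> d = 0 \<and> q = 0 \<and> p = 0 \<and> r = 1 \<or>
    k = 2 \<and> n = 1 \<and> d = 0 \<and> q = 1 \<and> p = 1 \<and> r = 0 \<or>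
    admissible (sqrt 3 ^ k) n d q p r"
  using assms
proof induction
  case leaf
  then show ?case by simp
next
  case (join k n d q p r k' n' d' q' p' r')
  \<comment> \<open>The path on three vertices rooted at an end and at its centre, and the path on
    four vertices rooted at an inner vertex. The first one explains the constant 0.385, as 2 / (3 *
    sqrt 3) = 0.3849.\<close>
  have 1: "admissible (sqrt 3 * 3) 2 1 0 1 1" "admissible (sqrt 3 * 3) 1 0 2 1 0" "admissible 9 2 1 2 2 0"
    using sqrt3_bounds unfolding admissible_def by - (intro conjI; linarith)+
  have 3: "sqrt 3 * (sqrt 3 * x) = 3 * x" for x
    by (simp flip: mult.assoc)
  from join.IH show ?case
  proof (elim disjE conjE)
    assume "admissible (sqrt 3 ^ k) n d q p r" "admissible (sqrt 3 ^ k') n' d' q' p' r'"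
    from admissible_join[OF this] show ?case by (simp add: power_add)
  next
    assume "admissible (sqrt 3 ^ k) n d q p r" "k' = 1" "n' = 1" "d' = 0" "q' = 0" "p' = 0" "r' = 1"
    then show ?case using admissible_scaled_sqrt3(1)[of "sqrt 3 ^ k" n d q p r] by (simp add: mult.commute)
  next
    assume "admissible (sqrt 3 ^ k) n d q p r" "k' = 2" "n' = 1" "d' = 0" "q' = 1" "p' = 1" "r' = 0"
    then show ?case using admissible_scaled_3(1)[of "sqrt 3 ^ k" n d q p r]
      by (simp add: power_add algebra_simps 3)
  next
    assume "admissible (sqrt 3 ^ k') n' d' q' p' r'" "k = 1" "n = 1" "d = 0" "q = 0" "p = 0" "r = 1"
    then show ?case using admissible_scaled_sqrt3(2)[of "sqrt 3 ^ k'" n' d' q' p' r']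
      by (simp add: algebra_simps)
  next
    assume "admissible (sqrt 3 ^ k') n' d' q' p' r'" "k = 2" "n = 1" "d = 0" "q = 1" "p = 1" "r = 0"
    then show ?case using admissible_scaled_3(2)[of "sqrt 3 ^ k'" n' d' q' p' r']
      by (simp add: power_add algebra_simps 3)
  qed (use 1 in \<open>simp_all add: numeral_eq_Suc 3\<close>)
qed

lemma profile_total_bound:
  assumes "profile k n d q p r"
  shows "real (n + d + q + p) \<le> sqrt 3 ^ k"
  using profile_bound[OF assms]
proof (elim disjE conjE)
  assume "admissible (sqrt 3 ^ k) n d q p r"
  then show ?thesis unfolding admissible_def by simp
qed simp_all

section \<open>Private neighbours in rooted trees\<close>

definition private_nbr :: "'a rel \<Rightarrow> 'a set \<Rightarrow> 'a \<Rightarrow> 'a \<Rightarrow> bool" where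
  "private_nbr E D v x \<longleftrightarrow> (v, x) \<in> E \<and> x \<notin> D \<and> (\<forall>u\<in>D. (u, x) \<in> E \<longrightarrow> u = v)"

definition privileged :: "'a rel \<Rightarrow> 'a set set" where
  "privileged E = {D. \<forall>v\<in>D. \<exists>x. private_nbr E D v x}"

text \<open>A join makes \<open>y\<close> a child of \<open>z\<close>, so children are attached one
  at a time and every step involves only two parts. Both orientations of an edge belong to the
  relation.\<close>

inductive rooted_tree :: "'a set \<Rightarrow> 'a rel \<Rightarrow> 'a \<Rightarrow> bool" where
  single: "rooted_tree {z} {} z"
| join: "rooted_tree V E z \<Longrightarrow> rooted_tree W F y \<Longrightarrow> V \<inter> W = {} \<Longrightarrow>
    rooted_tree (V \<union> W) (E \<union> F \<union> {(z, y), (y, z)}) z"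

lemma rooted_tree_props:
  assumes "rooted_tree V E z"
  shows "finite V" "E \<subseteq> V \<times> V" "z \<in> V" "irrefl E"
proof -
  from assms have "finite V \<and> E \<subseteq> V \<times> V \<and> z \<in> V \<and> irrefl E"
    by induction (auto simp: irrefl_def)
  then show "finite V" "E \<subseteq> V \<times> V" "z \<in> V" "irrefl E" by auto
qed

definition undominated :: "'a rel \<Rightarrow> 'a set \<Rightarrow> 'a \<Rightarrow> bool" where
  "undominated E D z \<longleftrightarrow> (\<forall>u\<in>D. (u, z) \<notin> E)"

definition served :: "'a rel \<Rightarrow> 'a set \<Rightarrow> 'a \<Rightarrow> bool" where
  "served E D z \<longleftrightarrow> (\<forall>v\<in>D - {z}. \<exists>x. private_nbr E D v x)"

text \<open>This is the requirement when a parent of \<open>z\<close> belongs to \<open>D\<close>: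
  it dominates \<open>z\<close>, which is then lost as a private neighbour for the vertices of the
  tree.\<close>

definition self_served :: "'a rel \<Rightarrow> 'a set \<Rightarrow> 'a \<Rightarrow> bool" where
  "self_served E D z \<longleftrightarrow> (\<forall>v\<in>D - {z}. \<exists>x. x \<noteq> z \<and> private_nbr E D v x)"

definition class_n where "class_n V E z = {D. D \<subseteq> V \<and> z \<notin> D \<and> served E D z \<and> undominated E D z}"
definition class_d where "class_d V E z = {D. D \<subseteq> V \<and> z \<notin> D \<and> self_served E D z \<and> \<not> undominated E D z}"
definition class_q where "class_q V E z = {D. D \<subseteq> V \<and> z \<notin> D \<and> served E D z \<and> \<not> self_served E D z}"
definition class_p where "class_p V E z = {D. D \<subseteq> V \<and> z \<in> D \<and> served E D z \<and> (\<exists>x. private_nbr E D z x)}"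
definition class_r where "class_r V E z = {D. D \<subseteq> V \<and> z \<in> D \<and> served E D z \<and> \<not> (\<exists>x. private_nbr E D z x)}"

lemmas class_defs = class_n_def class_d_def class_q_def class_p_def class_r_def

lemma self_servedD: "self_served E D z \<Longrightarrow> served E D z"
  unfolding self_served_def served_def by blast

text \<open>A vertex of \<open>D\<close> with private neighbour \<open>z\<close> would dominate
  \<open>z\<close>.\<close>

lemma self_served_if_undominated:
  assumes "undominated E D z" "served E D z"
  shows "self_served E D z"
proof -
  have "x \<noteq> z" if "private_nbr E D v x" "v \<in> D" for v x
    using assms(1) that unfolding private_nbr_def undominated_def by auto
  then show ?thesis using assms(2) unfolding self_served_def served_def by (meson DiffD1)
qed

section \<open>Private neighbours across the edge of a join\<close>

context
  fixes V W :: "'a set" and E F G :: "'a rel" and z y :: 'a and D :: "'a set"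
  assumes EV: "E \<subseteq> V \<times> V" "z \<in> V" and FW: "F \<subseteq> W \<times> W" "y \<in> W" "irrefl F"
    and disj: "V \<inter> W = {}" and G: "G = E \<union> F \<union> {(z, y), (y, z)}"
    and D: "D \<subseteq> V \<union> W"
begin

lemma arc_ends:
  "(u, v) \<in> E \<Longrightarrow> u \<in> V" "(u, v) \<in> E \<Longrightarrow> v \<in> V"
  "(u, v) \<in> F \<Longrightarrow> u \<in> W" "(u, v) \<in> F \<Longrightarrow> v \<in> W"
  "u \<in> V \<Longrightarrow> u \<notin> W" "z \<in> V" "y \<in> W" "(u, u) \<notin> F"
  using EV FW disj by (auto simp: irrefl_def)

lemma arc_join:
  "x \<in> V \<Longrightarrow> x \<noteq> z \<Longrightarrow> (u, x) \<in> G \<longleftrightarrow> (u, x) \<in> E"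
  "x \<in> W \<Longrightarrow> x \<noteq> y \<Longrightarrow> (u, x) \<in> G \<longleftrightarrow> (u, x) \<in> F"
  "(u, z) \<in> G \<longleftrightarrow> (u, z) \<in> E \<or> u = y"
  "(u, y) \<in> G \<longleftrightarrow> (u, y) \<in> F \<or> u = z"
  unfolding G using EV FW disj by auto

lemma undominated_join: "undominated G D z \<longleftrightarrow> undominated E (D \<inter> V) z \<and> y \<notin> D"
  using arc_ends(1) unfolding undominated_def arc_join by auto

lemma private_nbr_join_V:
  assumes "x \<in> V" "x \<noteq> z"
  shows "private_nbr G D v x \<longleftrightarrow> private_nbr E (D \<inter> V) v x"
  using assms(1) arc_ends(1) unfolding private_nbr_def arc_join(1)[OF assms] by auto

lemma private_nbr_join_W:
  assumes "x \<in> W" "x \<noteq> y"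
  shows "private_nbr G D v x \<longleftrightarrow> private_nbr F (D \<inter> W) v x"
  using assms(1) arc_ends(3) unfolding private_nbr_def arc_join(2)[OF assms] by auto

text \<open>The new edge adds exactly \<open>y\<close> to the neighbours of \<open>z\<close>. If
  \<open>y\<close> is in \<open>D\<close>, this spoils \<open>z\<close> for the vertices of
  \<open>V\<close>, but offers \<open>z\<close> to \<open>y\<close> when nothing in \<open>V\<close>
  dominates it.\<close>

lemma private_nbr_join_z:
  "private_nbr G D v z \<longleftrightarrow> private_nbr E (D \<inter> V) v z \<and> y \<notin> D \<or> v = y \<and> z \<notin> D \<and> undominated E (D \<inter> V) z"
proof -
  have "(y, z) \<notin> E" using arc_ends(1,5,7) by blast
  moreover have "(\<forall>u\<in>D. (u, z) \<in> G \<longrightarrow> u = v) \<longleftrightarrow>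
      (\<forall>u\<in>D \<inter> V. (u, z) \<in> E \<longrightarrow> u = v) \<and> (y \<in> D \<longrightarrow> y = v)"
    unfolding arc_join using arc_ends(1) by blast
  moreover have "y \<notin> V" using arc_ends(5,7) by blast
  ultimately show ?thesis
    using arc_ends(6) unfolding private_nbr_def undominated_def arc_join(3) by (cases "v = y") auto
qed

lemma private_nbr_join_y:
  "private_nbr G D v y \<longleftrightarrow> private_nbr F (D \<inter> W) v y \<and> z \<notin> D \<or> v = z \<and> y \<notin> D \<and> undominated F (D \<inter> W) y"
proof -
  have "(z, y) \<notin> F" using arc_ends(3,5,6) by blast
  moreover have "(\<forall>u\<in>D. (u, y) \<in> G \<longrightarrow> u = v) \<longleftrightarrow>
      (\<forall>u\<in>D \<inter> W. (u, y) \<in> F \<longrightarrow> u = v) \<and> (z \<in> D \<longrightarrow> z = v)"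
    unfolding arc_join using arc_ends(3) by blast
  moreover have "z \<notin> W" using arc_ends(5,6) by blast
  ultimately show ?thesis
    using arc_ends(7) unfolding private_nbr_def undominated_def arc_join(4) by (cases "v = z") auto
qed

lemma private_nbr_join_out: "private_nbr G D v x \<Longrightarrow> x \<in> V \<union> W"
  using EV FW unfolding private_nbr_def G by blast

lemma private_nbr_V: "private_nbr E A v x \<Longrightarrow> x \<in> V \<and> v \<in> V"
  and private_nbr_W: "private_nbr F A v x \<Longrightarrow> x \<in> W \<and> v \<in> W"
  using arc_ends(1-4) unfolding private_nbr_def by blast+

text \<open>All neighbours of such a \<open>v\<close> lie in \<open>V\<close>, and among the
  vertices of \<open>V\<close> only \<open>z\<close> has gained a neighbour.\<close>

lemma ex_private_nbr_join_V:
  assumes "v \<in> V" "v \<noteq> z"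
  shows "(\<exists>x. x \<noteq> z \<and> private_nbr G D v x) \<longleftrightarrow> (\<exists>x. x \<noteq> z \<and> private_nbr E (D \<inter> V) v x)"
    and "(\<exists>x. private_nbr G D v x) \<longleftrightarrow> (\<exists>x. (x = z \<longrightarrow> y \<notin> D) \<and> private_nbr E (D \<inter> V) v x)"
proof -
  have v: "v \<noteq> y" "v \<notin> W" using assms arc_ends(5,7) by blast+
  have 1: "private_nbr G D v x \<longleftrightarrow> (x = z \<longrightarrow> y \<notin> D) \<and> private_nbr E (D \<inter> V) v x" for x
  proof (cases "x = z \<or> x = y")
    case True
    then show ?thesis using v assms(2) private_nbr_join_z private_nbr_join_y private_nbr_W private_nbr_V arc_ends(5,7) by blast
  next
    case False
    then show ?thesis using v private_nbr_join_V private_nbr_join_W private_nbr_join_out private_nbr_V private_nbr_W by blast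
  qed
  show "(\<exists>x. x \<noteq> z \<and> private_nbr G D v x) \<longleftrightarrow> (\<exists>x. x \<noteq> z \<and> private_nbr E (D \<inter> V) v x)"
    and "(\<exists>x. private_nbr G D v x) \<longleftrightarrow> (\<exists>x. (x = z \<longrightarrow> y \<notin> D) \<and> private_nbr E (D \<inter> V) v x)"
    unfolding 1 by auto
qed

lemma ex_private_nbr_join_W:
  assumes "v \<in> W" "v \<noteq> y"
  shows "(\<exists>x. x \<noteq> z \<and> private_nbr G D v x) \<longleftrightarrow> (\<exists>x. (x = y \<longrightarrow> z \<notin> D) \<and> private_nbr F (D \<inter> W) v x)"
    and "(\<exists>x. private_nbr G D v x) \<longleftrightarrow> (\<exists>x. (x = y \<longrightarrow> z \<notin> D) \<and> private_nbr F (D \<inter> W) v x)"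
proof -
  have v: "v \<noteq> z" "v \<notin> V" using assms arc_ends(5,6) by blast+
  have 1: "private_nbr G D v x \<longleftrightarrow> (x = y \<longrightarrow> z \<notin> D) \<and> private_nbr F (D \<inter> W) v x" for x
  proof (cases "x = z \<or> x = y")
    case True
    then show ?thesis using v assms(2) private_nbr_join_z private_nbr_join_y private_nbr_W private_nbr_V arc_ends(5,6) by blast
  next
    case False
    then show ?thesis using v private_nbr_join_V private_nbr_join_W private_nbr_join_out private_nbr_V private_nbr_W by blast
  qed
  show "(\<exists>x. x \<noteq> z \<and> private_nbr G D v x) \<longleftrightarrow> (\<exists>x. (x = y \<longrightarrow> z \<notin> D) \<and> private_nbr F (D \<inter> W) v x)"
    and "(\<exists>x. private_nbr G D v x) \<longleftrightarrow> (\<exists>x. (x = y \<longrightarrow> z \<notin> D) \<and> private_nbr F (D \<inter> W) v x)"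
    using 1 arc_ends(5)[OF arc_ends(6)] private_nbr_W by metis+
qed

lemma ex_private_nbr_join_y:
  "(\<exists>x. x \<noteq> z \<and> private_nbr G D y x) \<longleftrightarrow> (\<exists>x. private_nbr F (D \<inter> W) y x)"
  "(\<exists>x. private_nbr G D y x) \<longleftrightarrow> (\<exists>x. private_nbr F (D \<inter> W) y x) \<or> z \<notin> D \<and> undominated E (D \<inter> V) z"
proof -
  have y: "y \<notin> V" "y \<noteq> z" using arc_ends(5,6,7) by blast+
  have "\<not> private_nbr F A y y" for A using arc_ends(8) unfolding private_nbr_def by simp
  note y = y this
  have 1: "private_nbr G D y x \<longleftrightarrow> private_nbr F (D \<inter> W) y x" if "x \<noteq> z" for x
  proof (cases "x = y")
    case True
    then show ?thesis using y private_nbr_join_y by blast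
  next
    case False
    then show ?thesis using y that private_nbr_join_V private_nbr_join_W private_nbr_join_out private_nbr_V private_nbr_W by blast
  qed
  show "(\<exists>x. x \<noteq> z \<and> private_nbr G D y x) \<longleftrightarrow> (\<exists>x. private_nbr F (D \<inter> W) y x)"
    using 1 private_nbr_W arc_ends(5)[OF arc_ends(6)] by metis
  show "(\<exists>x. private_nbr G D y x) \<longleftrightarrow> (\<exists>x. private_nbr F (D \<inter> W) y x) \<or> z \<notin> D \<and> undominated E (D \<inter> V) z"
    using 1 private_nbr_join_z[of y] y(1) private_nbr_W private_nbr_V arc_ends(5)[OF arc_ends(6)] by metis
qed

lemma ex_private_nbr_join_z:
  "(\<exists>x. private_nbr G D z x) \<longleftrightarrow> (\<exists>x. x \<noteq> z \<and> private_nbr E (D \<inter> V) z x) \<or>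
     private_nbr E (D \<inter> V) z z \<and> y \<notin> D \<or> y \<notin> D \<and> undominated F (D \<inter> W) y"
proof -
  have z: "z \<notin> W" "y \<noteq> z" using arc_ends(5,6,7) by blast+
  have "private_nbr G D z x \<longleftrightarrow> private_nbr E (D \<inter> V) z x" if "x \<noteq> z" "x \<noteq> y" for x
    using that z private_nbr_join_V private_nbr_join_W private_nbr_join_out private_nbr_V private_nbr_W by blast
  moreover have "\<not> private_nbr E A z y" "\<not> private_nbr F A z y" for A
    using private_nbr_V private_nbr_W z(1) arc_ends(5,7) by blast+
  ultimately show ?thesis using private_nbr_join_z[of z] private_nbr_join_y[of z] z by metis
qed

text \<open>An end of the new edge that lies in \<open>D\<close> has two effects: it spoils the
  other end as a private neighbour, and it may use the other end itself. For \<open>z\<close> the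
  second effect is not visible here, since \<open>served\<close> exempts the root.\<close>

lemma served_join:
  "served G D z \<longleftrightarrow>
     (if y \<in> D then self_served E (D \<inter> V) z \<and>
         ((\<exists>x. private_nbr F (D \<inter> W) y x) \<or> z \<notin> D \<and> undominated E (D \<inter> V) z)
       else served E (D \<inter> V) z) \<and>
     (if z \<in> D then self_served F (D \<inter> W) y else served F (D \<inter> W) y)"
proof -
  have "D - {z} = (D \<inter> V - {z}) \<union> (D \<inter> W - {y}) \<union> (D \<inter> {y})"
    using D arc_ends(5,6,7) by blast
  then have "served G D z \<longleftrightarrow> (\<forall>v \<in> D \<inter> V - {z}. \<exists>x. private_nbr G D v x) \<and>
      (\<forall>v \<in> D \<inter> W - {y}. \<exists>x. private_nbr G D v x) \<and> (y \<in> D \<longrightarrow> (\<exists>x. private_nbr G D y x))"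
    unfolding served_def by (simp add: ball_Un) blast
  moreover have "(\<forall>v \<in> D \<inter> V - {z}. \<exists>x. private_nbr G D v x) \<longleftrightarrow>
      (if y \<in> D then self_served E (D \<inter> V) z else served E (D \<inter> V) z)"
    unfolding served_def self_served_def using ex_private_nbr_join_V(2) by (simp add: Ball_def)
  moreover have "(\<forall>v \<in> D \<inter> W - {y}. \<exists>x. private_nbr G D v x) \<longleftrightarrow>
      (if z \<in> D then self_served F (D \<inter> W) y else served F (D \<inter> W) y)"
    unfolding served_def self_served_def using ex_private_nbr_join_W(2) by (simp add: Ball_def)
  ultimately show ?thesis using ex_private_nbr_join_y(2) by auto
qed

lemma self_served_join:
  "self_served G D z \<longleftrightarrow> self_served E (D \<inter> V) z \<and>
     (y \<in> D \<longrightarrow> (\<exists>x. private_nbr F (D \<inter> W) y x)) \<and>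
     (if z \<in> D then self_served F (D \<inter> W) y else served F (D \<inter> W) y)"
proof -
  have "D - {z} = (D \<inter> V - {z}) \<union> (D \<inter> W - {y}) \<union> (D \<inter> {y})"
    using D arc_ends(5,6,7) by blast
  then have "self_served G D z \<longleftrightarrow> (\<forall>v \<in> D \<inter> V - {z}. \<exists>x. x \<noteq> z \<and> private_nbr G D v x) \<and>
      (\<forall>v \<in> D \<inter> W - {y}. \<exists>x. x \<noteq> z \<and> private_nbr G D v x) \<and> (y \<in> D \<longrightarrow> (\<exists>x. x \<noteq> z \<and> private_nbr G D y x))"
    unfolding self_served_def by (simp add: ball_Un) blast
  moreover have "(\<forall>v \<in> D \<inter> V - {z}. \<exists>x. x \<noteq> z \<and> private_nbr G D v x) \<longleftrightarrow> self_served E (D \<inter> V) z"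
    unfolding self_served_def using ex_private_nbr_join_V(1) by (simp add: Ball_def)
  moreover have "(\<forall>v \<in> D \<inter> W - {y}. \<exists>x. x \<noteq> z \<and> private_nbr G D v x) \<longleftrightarrow>
      (if z \<in> D then self_served F (D \<inter> W) y else served F (D \<inter> W) y)"
    unfolding served_def self_served_def using ex_private_nbr_join_W(1) by (simp add: Ball_def)
  ultimately show ?thesis using ex_private_nbr_join_y(1) by auto
qed

lemma ex_private_nbr_join_root:
  assumes "z \<in> D"
  shows "(\<exists>x. private_nbr G D z x) \<longleftrightarrow>
    (\<exists>x. private_nbr E (D \<inter> V) z x) \<or> y \<notin> D \<and> undominated F (D \<inter> W) y"
proof -
  have "\<not> private_nbr E (D \<inter> V) z z" using assms arc_ends(6) unfolding private_nbr_def by blast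
  then show ?thesis using ex_private_nbr_join_z by metis
qed

section \<open>Splitting the five classes at a join\<close>

lemma root_mem: "z \<in> D \<inter> V \<longleftrightarrow> z \<in> D" "y \<in> D \<inter> W \<longleftrightarrow> y \<in> D"
  using arc_ends(6,7) by auto

text \<open>With both roots outside \<open>D\<close>, the tree of \<open>y\<close> need only be
  served, and the sets of this kind make up the three classes without the root. Here and below an
  inclusion suffices, as only upper bounds on the counts are wanted.\<close>

lemma class_n_join:
  assumes "D \<in> class_n (V \<union> W) G z"
  shows "(D \<inter> V, D \<inter> W) \<in> class_n V E z \<times> (class_n W F y \<union> class_d W F y \<union> class_q W F y)"
  using assms root_mem self_served_if_undominated[of F "D \<inter> W" y] self_servedD[of F "D \<inter> W" y]
  unfolding class_defs undominated_join served_join mem_Collect_eq mem_Times_iff Un_iff fst_conv snd_conv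
  by auto

text \<open>Either \<open>y\<close> is the first to dominate \<open>z\<close> and, as it must not
  depend on \<open>z\<close>, has a private neighbour in its own tree; or \<open>z\<close> was
  dominated before, and \<open>y\<close> may be in \<open>D\<close> with a private neighbour of its
  own or not in \<open>D\<close> at all.\<close>

lemma class_d_join:
  assumes "D \<in> class_d (V \<union> W) G z"
  shows "(D \<inter> V, D \<inter> W) \<in> class_n V E z \<times> class_p W F y \<union>
    class_d V E z \<times> (class_n W F y \<union> class_d W F y \<union> class_q W F y \<union> class_p W F y)"
  using assms root_mem self_servedD[of E "D \<inter> V" z] self_servedD[of F "D \<inter> W" y]
  unfolding class_defs undominated_join self_served_join mem_Collect_eq mem_Times_iff Un_iff fst_conv snd_conv
  by auto

text \<open>The vertex that depends on \<open>z\<close> is either \<open>y\<close>, which then finds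
  \<open>z\<close> undominated and has no private neighbour in its own tree, or a vertex of
  \<open>V\<close>, in which case \<open>y\<close> must stay outside \<open>D\<close>.\<close>

lemma class_q_join:
  assumes "D \<in> class_q (V \<union> W) G z"
  shows "(D \<inter> V, D \<inter> W) \<in> class_n V E z \<times> class_r W F y \<union>
    class_q V E z \<times> (class_n W F y \<union> class_d W F y \<union> class_q W F y)"
  using assms root_mem self_servedD[of E "D \<inter> V" z] self_servedD[of F "D \<inter> W" y]
  unfolding class_defs served_join self_served_join mem_Collect_eq mem_Times_iff Un_iff fst_conv snd_conv
  by (auto split: if_splits)

text \<open>As \<open>z\<close> is in \<open>D\<close>, the tree of \<open>y\<close> has to do
  without \<open>y\<close> as a private neighbour, which excludes \<open>class_q\<close>, and
  \<open>y\<close> cannot use \<open>z\<close>, which excludes \<open>class_r\<close>. If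
  \<open>z\<close> had no private neighbour before, only an undominated \<open>y\<close> can become
  one.\<close>

lemma class_p_join:
  assumes "D \<in> class_p (V \<union> W) G z"
  shows "(D \<inter> V, D \<inter> W) \<in> class_p V E z \<times> (class_n W F y \<union> class_d W F y \<union> class_p W F y) \<union> class_r V E z \<times> class_n W F y"
proof -
  have z: "z \<in> D" using assms unfolding class_p_def by simp
  show ?thesis
    using assms root_mem z self_servedD[of E "D \<inter> V" z] self_servedD[of F "D \<inter> W" y]
    unfolding class_defs served_join ex_private_nbr_join_root[OF z] mem_Collect_eq mem_Times_iff Un_iff fst_conv snd_conv
    by (auto split: if_splits)
qed

text \<open>Of the classes left for \<open>y\<close> when \<open>z\<close> is in \<open>D\<close>,
  \<open>class_n\<close> drops out: there \<open>y\<close> would become a private neighbour of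
  \<open>z\<close>.\<close>

lemma class_r_join:
  assumes "D \<in> class_r (V \<union> W) G z"
  shows "(D \<inter> V, D \<inter> W) \<in> class_r V E z \<times> (class_d W F y \<union> class_p W F y)"
proof -
  have z: "z \<in> D" using assms unfolding class_r_def by simp
  show ?thesis
    using assms root_mem z self_servedD[of E "D \<inter> V" z] self_servedD[of F "D \<inter> W" y]
    unfolding class_defs served_join ex_private_nbr_join_root[OF z] mem_Collect_eq mem_Times_iff Un_iff fst_conv snd_conv
    by (auto split: if_splits)
qed

end

lemma card_split_le:
  assumes "S \<subseteq> Pow (V \<union> W)" "\<And>D. D \<subseteq> V \<union> W \<Longrightarrow> D \<in> S \<Longrightarrow> (D \<inter> V, D \<inter> W) \<in> T"
    "finite T" "card T \<le> k"
  shows "card S \<le> k"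
proof -
  have "card S \<le> card T"
  proof (rule card_inj_on_le[OF _ _ assms(3)])
    show "inj_on (\<lambda>D. (D \<inter> V, D \<inter> W)) S"
      using assms(1) by (intro inj_onI) blast
    show "(\<lambda>D. (D \<inter> V, D \<inter> W)) ` S \<subseteq> T"
      using assms(1,2) by blast
  qed
  then show ?thesis using assms(4) by simp
qed

lemma card_Un_le_add: "card A \<le> a \<Longrightarrow> card B \<le> b \<Longrightarrow> card (A \<union> B) \<le> a + b"
  using card_Un_le[of A B] by linarith

lemma card_times_le: "card A \<le> a \<Longrightarrow> card B \<le> b \<Longrightarrow> card (A \<times> B) \<le> a * b"
  by (simp add: card_cartesian_product mult_le_mono)

text \<open>The numbers of a profile need only dominate the class sizes: the recurrence has no
  negative terms, so upper bounds for the parts give upper bounds for the join.\<close>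

lemma rooted_tree_profile:
  assumes "rooted_tree V E z"
  shows "\<exists>n d q p r. profile (card V) n d q p r \<and> card (class_n V E z) \<le> n \<and> card (class_d V E z) \<le> d \<and>
    card (class_q V E z) \<le> q \<and> card (class_p V E z) \<le> p \<and> card (class_r V E z) \<le> r"
  using assms
proof induction
  case (single z)
  have sub: "D \<subseteq> {z} \<longleftrightarrow> D = {} \<or> D = {z}" for D by auto
  have "class_n {z} {} z = {{}}" "class_d {z} {} z = {}" "class_q {z} {} z = {}" "class_p {z} {} z = {}" "class_r {z} {} z = {{z}}"
    unfolding class_defs sub served_def self_served_def undominated_def private_nbr_def by auto
  then show ?case using profile.leaf by force
next
  case (join V E z W F y)
  note t = rooted_tree_props[OF join.hyps(1)] rooted_tree_props[OF join.hyps(2)]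
  have fin: "finite (class_n A G x)" "finite (class_d A G x)" "finite (class_q A G x)" "finite (class_p A G x)" "finite (class_r A G x)"
    if "finite A" for A G and x :: 'a
    unfolding class_defs using that by (auto intro: finite_subset[of _ "Pow A"])
  note fin = fin[OF t(1)] fin[OF t(5)]
  obtain n d q p r where 1: "profile (card V) n d q p r" "card (class_n V E z) \<le> n" "card (class_d V E z) \<le> d"
    "card (class_q V E z) \<le> q" "card (class_p V E z) \<le> p" "card (class_r V E z) \<le> r"
    using join.IH(1) by blast
  obtain n' d' q' p' r' where 2: "profile (card W) n' d' q' p' r'" "card (class_n W F y) \<le> n'" "card (class_d W F y) \<le> d'"
    "card (class_q W F y) \<le> q'" "card (class_p W F y) \<le> p'" "card (class_r W F y) \<le> r'"
    using join.IH(2) by blast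
  let ?G = "E \<union> F \<union> {(z, y), (y, z)}"
  note j = t(2,3) t(6,7,8) join.hyps(3) refl[of ?G]
  have sub: "class_n (V \<union> W) ?G z \<subseteq> Pow (V \<union> W)" "class_d (V \<union> W) ?G z \<subseteq> Pow (V \<union> W)"
    "class_q (V \<union> W) ?G z \<subseteq> Pow (V \<union> W)" "class_p (V \<union> W) ?G z \<subseteq> Pow (V \<union> W)" "class_r (V \<union> W) ?G z \<subseteq> Pow (V \<union> W)"
    unfolding class_defs by auto
  have "card (class_n (V \<union> W) ?G z) \<le> n * (n' + d' + q')"
    by (rule card_split_le[OF sub(1) class_n_join[OF j]])
      (assumption, assumption, use fin in simp, intro card_times_le card_Un_le_add 1 2)
  moreover have "card (class_d (V \<union> W) ?G z) \<le> n * p' + d * (n' + d' + q' + p')"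
    by (rule card_split_le[OF sub(2) class_d_join[OF j]])
      (assumption, assumption, use fin in simp, intro card_times_le card_Un_le_add 1 2)
  moreover have "card (class_q (V \<union> W) ?G z) \<le> n * r' + q * (n' + d' + q')"
    by (rule card_split_le[OF sub(3) class_q_join[OF j]])
      (assumption, assumption, use fin in simp, intro card_times_le card_Un_le_add 1 2)
  moreover have "card (class_p (V \<union> W) ?G z) \<le> p * (n' + d' + p') + r * n'"
    by (rule card_split_le[OF sub(4) class_p_join[OF j]])
      (assumption, assumption, use fin in simp, intro card_times_le card_Un_le_add 1 2)
  moreover have "card (class_r (V \<union> W) ?G z) \<le> r * (d' + p')"
    by (rule card_split_le[OF sub(5) class_r_join[OF j]])
      (assumption, assumption, use fin in simp, intro card_times_le card_Un_le_add 1 2)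
  moreover have "card (V \<union> W) = card V + card W"
    using t(1,5) join.hyps(3) by (simp add: card_Un_disjoint)
  ultimately show ?case using profile.join[OF 1(1) 2(1)] by metis
qed

section \<open>Forests\<close>

text \<open>\<open>class_r\<close> is left out, because there the root itself has no private
  neighbour.\<close>

lemma rooted_tree_privileged_bound:
  assumes "rooted_tree V E z"
  shows "real (card (Pow V \<inter> privileged E)) \<le> sqrt 3 ^ card V"
proof -
  obtain n d q p r where 1: "profile (card V) n d q p r" "card (class_n V E z) \<le> n"
    "card (class_d V E z) \<le> d" "card (class_q V E z) \<le> q" "card (class_p V E z) \<le> p"
    using rooted_tree_profile[OF assms] by blast
  have "Pow V \<inter> privileged E \<subseteq> class_n V E z \<union> class_d V E z \<union> class_q V E z \<union> class_p V E z"
    unfolding class_defs privileged_def served_def by auto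
  moreover have "finite (class_n V E z \<union> class_d V E z \<union> class_q V E z \<union> class_p V E z)"
    using rooted_tree_props(1)[OF assms] unfolding class_defs
    by (auto intro: finite_subset[of _ "Pow V"])
  moreover have "card (class_n V E z \<union> class_d V E z \<union> class_q V E z \<union> class_p V E z) \<le> n + d + q + p"
    by (intro card_Un_le_add 1)
  ultimately have "card (Pow V \<inter> privileged E) \<le> n + d + q + p"
    by (meson card_mono order_trans)
  then show ?thesis using profile_total_bound[OF 1(1)] by linarith
qed

text \<open>Acyclicity in the form that every edge is a bridge: this passes to symmetric
  subrelations, and deleting an edge separates its ends at once. Loops are excluded because the
  closure is reflexive.\<close>

definition forest_rel :: "'a rel \<Rightarrow> bool" where
  "forest_rel E \<longleftrightarrow> sym E \<and> (\<forall>(z, y) \<in> E. (z, y) \<notin> (E - {(z, y), (y, z)})\<^sup>*)"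

lemma forest_rel_Diff_edge:
  assumes "forest_rel E"
  shows "forest_rel (E - {(z, y), (y, z)})"
proof -
  have "(a, b) \<notin> (E - {(z, y), (y, z)} - {(a, b), (b, a)})\<^sup>*" if "(a, b) \<in> E" for a b
    using assms that rtrancl_mono[of "E - {(z, y), (y, z)} - {(a, b), (b, a)}" "E - {(a, b), (b, a)}"]
    unfolding forest_rel_def by blast
  then show ?thesis using assms unfolding forest_rel_def sym_def by auto
qed

lemma forest_rel_Restr:
  assumes "forest_rel E"
  shows "forest_rel (Restr E A)"
proof -
  have "(a, b) \<notin> (Restr E A - {(a, b), (b, a)})\<^sup>*" if "(a, b) \<in> E" for a b
    using assms that rtrancl_mono[of "Restr E A - {(a, b), (b, a)}" "E - {(a, b), (b, a)}"]
    unfolding forest_rel_def by blast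
  then show ?thesis using assms unfolding forest_rel_def sym_def by auto
qed

lemma component_closed: "u \<in> E\<^sup>* `` {z} \<Longrightarrow> (u, v) \<in> E \<Longrightarrow> v \<in> E\<^sup>* `` {z}"
  by (auto intro: rtrancl_into_rtrancl)

text \<open>Deleting an edge between \<open>z\<close> and \<open>y\<close> separates their
  components, as it is a bridge. Both are rooted trees by induction on the number of arcs, and a
  join puts the edge back.\<close>

lemma forest_component_rooted_tree:
  assumes "finite E" "forest_rel E"
  shows "rooted_tree (E\<^sup>* `` {z}) (Restr E (E\<^sup>* `` {z})) z"
  using assms
proof (induction "card E" arbitrary: E z rule: less_induct)
  case less
  have irr: "(u, u) \<notin> E" for u using less.prems(2) unfolding forest_rel_def by auto
  show ?case
  proof (cases "\<exists>y. (z, y) \<in> E")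
    case False
    then have "E\<^sup>* `` {z} = {z}" by (auto elim: converse_rtranclE)
    then show ?thesis using rooted_tree.single[of z] irr by auto
  next
    case True
    then obtain y where y: "(z, y) \<in> E" by blast
    define F where "F = E - {(z, y), (y, z)}"
    have "card F < card E"
      unfolding F_def using y less.prems(1) by (intro psubset_card_mono) auto
    moreover have F: "finite F" "forest_rel F" "sym F"
      using less.prems forest_rel_Diff_edge[of E z y] unfolding F_def forest_rel_def by auto
    ultimately have IH: "rooted_tree (F\<^sup>* `` {x}) (Restr F (F\<^sup>* `` {x})) x" for x
      using less.hyps by blast
    have E: "E = F \<union> {(z, y), (y, z)}"
      using y less.prems(2) unfolding F_def forest_rel_def sym_def by blast
    have symF: "(a, b) \<in> F\<^sup>* \<Longrightarrow> (b, a) \<in> F\<^sup>*" for a b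
      using F(3) sym_rtrancl symD by metis
    have "(z, y) \<notin> F\<^sup>*" using y less.prems(2) unfolding F_def forest_rel_def by blast
    then have disj: "F\<^sup>* `` {z} \<inter> F\<^sup>* `` {y} = {}"
      using symF by (auto dest: rtrancl_trans)
    have comp: "E\<^sup>* `` {z} = F\<^sup>* `` {z} \<union> F\<^sup>* `` {y}"
    proof
      have "(z, x) \<in> E\<^sup>* \<Longrightarrow> x \<in> F\<^sup>* `` {z} \<union> F\<^sup>* `` {y}" for x
        by (induction rule: rtrancl_induct) (auto simp: E intro: rtrancl_into_rtrancl)
      then show "E\<^sup>* `` {z} \<subseteq> F\<^sup>* `` {z} \<union> F\<^sup>* `` {y}" by blast
      have "F\<^sup>* \<subseteq> E\<^sup>*" unfolding E by (intro rtrancl_mono) blast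
      moreover have "(z, y) \<in> E\<^sup>*" using y by blast
      ultimately show "F\<^sup>* `` {z} \<union> F\<^sup>* `` {y} \<subseteq> E\<^sup>* `` {z}"
        by (auto dest: rtrancl_trans)
    qed
    have "b \<in> F\<^sup>* `` {x} \<longleftrightarrow> a \<in> F\<^sup>* `` {x}" if "(a, b) \<in> F" for a b x
      using that F(3) component_closed[of _ F x] unfolding sym_def by blast
    then have "Restr E (E\<^sup>* `` {z}) =
        Restr F (F\<^sup>* `` {z}) \<union> Restr F (F\<^sup>* `` {y}) \<union> {(z, y), (y, z)}"
      unfolding comp by (auto simp: E)
    then show ?thesis using rooted_tree.join[OF IH IH disj] comp by simp
  qed
qed

text \<open>Private neighbours do not cross components, so splitting off a component bounds the
  count by a product, while the exponents add.\<close>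

lemma forest_privileged_bound:
  assumes "finite V" "E \<subseteq> V \<times> V" "forest_rel E"
  shows "real (card (Pow V \<inter> privileged E)) \<le> sqrt 3 ^ card V"
  using assms
proof (induction "card V" arbitrary: V E rule: less_induct)
  case less
  show ?case
  proof (cases "V = {}")
    case True
    then have "card (Pow V \<inter> privileged E) \<le> card {{} :: 'a set}"
      by (intro card_mono) auto
    then show ?thesis using True by simp
  next
    case False
    then obtain z where z: "z \<in> V" by blast
    define C where "C = E\<^sup>* `` {z}"
    have symE: "sym E" using less.prems(3) unfolding forest_rel_def by blast
    have C: "C \<subseteq> V" "z \<in> C"
    proof -
      have "(z, x) \<in> E\<^sup>* \<Longrightarrow> x \<in> V" for x
        by (induction rule: rtrancl_induct) (use z less.prems(2) in auto)
      then show "C \<subseteq> V" "z \<in> C" unfolding C_def by auto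
    qed
    define W where "W = V - C"
    have V: "V = C \<union> W" "C \<inter> W = {}" "finite C" "finite W"
      using C less.prems(1) finite_subset unfolding W_def by auto
    have closed: "b \<in> C \<longleftrightarrow> a \<in> C" if "(a, b) \<in> E" for a b
      using that symE component_closed[of _ E z] unfolding C_def sym_def by blast
    have "finite E" using less.prems(1,2) finite_subset by blast
    then have 1: "real (card (Pow C \<inter> privileged (Restr E C))) \<le> sqrt 3 ^ card C"
      using rooted_tree_privileged_bound[OF forest_component_rooted_tree[OF _ less.prems(3)]]
      unfolding C_def by blast
    have "card W < card V"
      using C z less.prems(1) unfolding W_def by (intro psubset_card_mono) auto
    then have 2: "real (card (Pow W \<inter> privileged (Restr E W))) \<le> sqrt 3 ^ card W"
      by (rule less.hyps) (use V forest_rel_Restr less.prems in auto)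
    have "card (Pow V \<inter> privileged E) \<le>
        card (Pow C \<inter> privileged (Restr E C)) * card (Pow W \<inter> privileged (Restr E W))"
    proof (rule card_split_le[of _ C W "(Pow C \<inter> privileged (Restr E C)) \<times> (Pow W \<inter> privileged (Restr E W))"])
      fix D assume D: "D \<in> Pow V \<inter> privileged E" "D \<subseteq> C \<union> W"
      have "D \<inter> A \<in> privileged (Restr E A)" if "\<And>a b. (a, b) \<in> E \<Longrightarrow> b \<in> A \<longleftrightarrow> a \<in> A" for A
        unfolding privileged_def
      proof safe
        fix v assume v: "v \<in> D" "v \<in> A"
        then obtain x where x: "private_nbr E D v x" using D unfolding privileged_def by blast
        then have "x \<in> A" using that v(2) unfolding private_nbr_def by blast
        then show "\<exists>x. private_nbr (Restr E A) (D \<inter> A) v x" using x v(2) by (intro exI[of _ x]) (simp add: private_nbr_def)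
      qed
      moreover have "b \<in> W \<longleftrightarrow> a \<in> W" if "(a, b) \<in> E" for a b
        using that closed less.prems(2) unfolding W_def by blast
      ultimately have "D \<inter> C \<in> privileged (Restr E C)" "D \<inter> W \<in> privileged (Restr E W)"
        using closed by simp_all
      then show "(D \<inter> C, D \<inter> W) \<in> (Pow C \<inter> privileged (Restr E C)) \<times> (Pow W \<inter> privileged (Restr E W))"
        by simp
    qed (use V in \<open>auto simp: card_cartesian_product\<close>)
    then have "real (card (Pow V \<inter> privileged E)) \<le> sqrt 3 ^ card C * sqrt 3 ^ card W"
      using mult_mono[OF 1 2] by (simp flip: of_nat_mult)
    then show ?thesis
      using V card_Un_disjoint[of C W] by (simp add: power_add)
  qed
qed

text \<open>A path from \<open>z\<close> to \<open>y\<close> that avoids their edge closes up with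
  it to a cycle. Walks are first shortened to paths, since a cycle may not repeat vertices.\<close>

lemma undirected_forest_rel:
  assumes "undirected_forest G"
  shows "finite (pverts G)" "parcs G \<subseteq> pverts G \<times> pverts G" "forest_rel (parcs G)"
proof -
  interpret pair_graph G using assms unfolding undirected_forest_def by blast
  have nocyc: "\<not> (cycle p \<and> 3 \<le> length p)" for p
    using assms unfolding undirected_forest_def by blast
  show "finite (pverts G)" by (rule pair_finite_verts)
  show wf: "parcs G \<subseteq> pverts G \<times> pverts G" using wellformed' by auto
  have "sym (parcs G)" using pair_sym_arcs unfolding symmetric_def by simp
  moreover have "(z, y) \<notin> (parcs G - {(z, y), (y, z)})\<^sup>*" if e: "(z, y) \<in> parcs G" for z y
  proof
    define F where "F = parcs G - {(z, y), (y, z)}"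
    assume "(z, y) \<in> (parcs G - {(z, y), (y, z)})\<^sup>*"
    then have "(z, y) \<in> F\<^sup>*" unfolding F_def .
    then have "\<exists>p. awalk z p y \<and> set p \<subseteq> F"
    proof (induction rule: converse_rtrancl_induct)
      case base
      then show ?case using e wf by (intro exI[of _ "[]"]) (auto simp: awalk_Nil_iff)
    next
      case (step a b)
      then obtain p where "awalk b p y" "set p \<subseteq> F" by blast
      then have "awalk a ((a, b) # p) y" "set ((a, b) # p) \<subseteq> F"
        using step(1) by (simp_all add: awalk_Cons_iff F_def)
      then show ?case by blast
    qed
    then obtain p where p: "awalk z p y" "set p \<subseteq> parcs G - {(z, y), (y, z)}"
      unfolding F_def by blast
    define p' where "p' = awalk_to_apath p"
    have p': "apath z p' y" "set p' \<subseteq> parcs G - {(z, y), (y, z)}"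
      using p(2) awalk_to_apath_subset[OF p(1)] apath_awalk_to_apath[OF p(1)] unfolding p'_def by auto
    have zy: "z \<noteq> y" using e no_loops' by blast
    have "(y, z) \<in> parcs G" using \<open>sym (parcs G)\<close> e by (auto dest: symD)
    then have "awalk y ((y, z) # p') y" "distinct (tl (pawalk_verts y ((y, z) # p')))"
      using p'(1) by (auto simp: awalk_Cons_iff apath_def)
    then have "cycle ((y, z) # p')" unfolding cycle_def by blast
    \<comment> \<open>Only cycles of length at least 3 are forbidden. An empty path would give
      \<open>z = y\<close>, and a single arc would be the deleted \<open>(z, y)\<close>.\<close>
    moreover have "2 \<le> length p'"
    proof (rule ccontr)
      assume "\<not> 2 \<le> length p'"
      then consider "p' = []" | a where "p' = [a]"
        by (cases p'; cases "tl p'") auto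
      then show False
        using p' zy by cases (auto simp: apath_def awalk_Cons_iff awalk_Nil_iff)
    qed
    ultimately show False using nocyc[of "(y, z) # p'"] by simp
  qed
  ultimately show "forest_rel (parcs G)" unfolding forest_rel_def by blast
qed

section \<open>Minimal Roman dominating functions as vertex sets\<close>

definition rdf_of :: "'a pair_pre_digraph \<Rightarrow> 'a set \<Rightarrow> 'a \<Rightarrow> nat" where
  "rdf_of G D = (\<lambda>v\<in>pverts G. if v \<in> D then 2 else if \<exists>u\<in>D. (u, v) \<in> parcs G then 0 else 1)"

lemma rdf_of_eq_2: "D \<subseteq> pverts G \<Longrightarrow> {v \<in> pverts G. rdf_of G D v = 2} = D"
  unfolding rdf_of_def by auto

lemma inj_on_rdf_of: "inj_on (rdf_of G) (Pow (pverts G))"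
  by (rule inj_onI) (metis PowD rdf_of_eq_2)

context
  fixes G :: "'a pair_pre_digraph"
  assumes wf: "parcs G \<subseteq> pverts G \<times> pverts G" and sym: "sym (parcs G)"
begin

text \<open>Let \<open>g\<close> be a smaller rdf; its vertices of value 2 lie in \<open>D\<close>.
  A private neighbour of \<open>v\<close> has value 0 also under \<open>g\<close> and can be
  dominated by \<open>v\<close> only, so \<open>v\<close> keeps the value 2. A vertex of value 1 has
  no neighbour in \<open>D\<close> and cannot drop to 0.\<close>

lemma rdf_of_minimal:
  assumes "D \<subseteq> pverts G" "D \<in> privileged (parcs G)"
  shows "minimal_rdf G (rdf_of G D)"
proof -
  let ?f = "rdf_of G D"
  have rdf: "rdf G ?f"
    using assms(1) sym unfolding rdf_def rdf_of_def by (fastforce dest: symD split: if_splits)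
  have "g = ?f" if g: "rdf G g" and le: "\<forall>v\<in>pverts G. g v \<le> ?f v" for g
  proof (rule PiE_ext[of _ "pverts G" "\<lambda>_. {0, 1, 2}"])
    fix v assume v: "v \<in> pverts G"
    have D: "u \<in> D" if "u \<in> pverts G" "g u = 2" for u
      using le[rule_format, OF that(1)] that unfolding rdf_of_def by (auto split: if_splits)
    have dom: "\<exists>u\<in>D. (u, w) \<in> parcs G \<and> g u = 2" if "w \<in> pverts G" "g w = 0" for w
      using g that sym D unfolding rdf_def by (metis symD)
    consider "v \<in> D" | "v \<notin> D" "\<exists>u\<in>D. (u, v) \<in> parcs G" | "v \<notin> D" "\<not> (\<exists>u\<in>D. (u, v) \<in> parcs G)"
      by blast
    then show "g v = ?f v"
    proof cases
      case 1
      then obtain x where x: "private_nbr (parcs G) D v x" using assms(2) unfolding privileged_def by blast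
      then have "x \<in> pverts G" "?f x = 0" using wf 1 unfolding private_nbr_def rdf_of_def by auto
      then obtain u where "u \<in> D" "(u, x) \<in> parcs G" "g u = 2" using le dom by fastforce
      then show ?thesis using x 1 v unfolding private_nbr_def rdf_of_def by auto
    next
      case 2
      then have "?f v = 0" using v unfolding rdf_of_def by auto
      then show ?thesis using le v by fastforce
    next
      case 3
      then have "g v \<noteq> 0" "?f v = 1" using dom v unfolding rdf_of_def by auto
      then show ?thesis using le v by fastforce
    qed
  qed (use g rdf in \<open>auto simp: rdf_def\<close>)
  then show ?thesis using rdf unfolding minimal_rdf_def by blast
qed

text \<open>Minimality rules out two ways of lowering a value: a vertex of \<open>D\<close> without
  private neighbour could be set to 1, since its neighbours of value 0 have other neighbours in
  \<open>D\<close>, and a vertex outside \<open>D\<close> with a neighbour in \<open>D\<close> could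
  be set to 0.\<close>

lemma minimal_is_rdf_of:
  assumes "minimal_rdf G f"
  defines "D \<equiv> {v \<in> pverts G. f v = 2}"
  shows "D \<in> privileged (parcs G)" "f = rdf_of G D"
proof -
  have f: "f \<in> pverts G \<rightarrow>\<^sub>E {0, 1, 2}"
    "\<And>v. v \<in> pverts G \<Longrightarrow> f v = 0 \<Longrightarrow> \<exists>u\<in>pverts G. (v, u) \<in> parcs G \<and> f u = 2"
    and min: "\<And>g. rdf G g \<Longrightarrow> \<forall>v\<in>pverts G. g v \<le> f v \<Longrightarrow> g = f"
    using assms(1) unfolding minimal_rdf_def rdf_def by blast+
  have upd: "f(v := c) \<in> pverts G \<rightarrow>\<^sub>E {0, 1, 2}" if "v \<in> pverts G" "c \<in> {0, 1, 2}" for v c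
    using f(1) that by (auto simp: PiE_iff extensional_def)
  show "D \<in> privileged (parcs G)"
    unfolding privileged_def
  proof (intro CollectI ballI, rule ccontr)
    fix v assume v: "v \<in> D" and np: "\<nexists>x. private_nbr (parcs G) D v x"
    have "\<exists>u\<in>pverts G. (w, u) \<in> parcs G \<and> (f(v := 1)) u = 2"
      if w: "w \<in> pverts G" "(f(v := 1)) w = 0" for w
    proof -
      have w': "w \<noteq> v" "f w = 0" using w by (auto split: if_splits)
      then obtain u where u: "u \<in> pverts G" "(w, u) \<in> parcs G" "f u = 2" using f(2) w(1) by blast
      show ?thesis
      proof (cases "u = v")
        case True
        then have "(v, w) \<in> parcs G" using u sym by (auto dest: symD)
        moreover have "w \<notin> D" using w' unfolding D_def by simp
        ultimately obtain u' where "u' \<in> D" "(u', w) \<in> parcs G" "u' \<noteq> v"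
          using np unfolding private_nbr_def by blast
        then show ?thesis using sym unfolding D_def by (auto dest: symD)
      qed (use u in auto)
    qed
    then have "rdf G (f(v := 1))" unfolding rdf_def using upd v D_def by auto
    then have "f(v := 1) = f" using v by (intro min) (auto simp: D_def)
    then show False using v unfolding D_def by (auto dest: fun_cong[of _ _ v])
  qed
  show "f = rdf_of G D"
  proof (rule PiE_ext[OF f(1)])
    show "rdf_of G D \<in> pverts G \<rightarrow>\<^sub>E {0, 1, 2}" unfolding rdf_of_def by auto
    fix v assume v: "v \<in> pverts G"
    have "f v = 0" if d: "\<exists>u\<in>D. (u, v) \<in> parcs G" "v \<notin> D"
    proof -
      obtain u where u: "u \<in> pverts G" "f u = 2" "(v, u) \<in> parcs G" "u \<noteq> v"
        using d sym unfolding D_def by (auto dest: symD)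
      have "rdf G (f(v := 0))"
        unfolding rdf_def
      proof (intro conjI ballI impI)
        show "f(v := 0) \<in> pverts G \<rightarrow>\<^sub>E {0, 1, 2}" using upd v by blast
        fix w assume w: "w \<in> pverts G" "(f(v := 0)) w = 0"
        show "\<exists>u\<in>pverts G. (w, u) \<in> parcs G \<and> (f(v := 0)) u = 2"
        proof (cases "w = v")
          case False
          then obtain x where "x \<in> pverts G" "(w, x) \<in> parcs G" "f x = 2" using f(2) w by auto
          then show ?thesis using d(2) v unfolding D_def by auto
        qed (use u in auto)
      qed
      then have "f(v := 0) = f" by (intro min) auto
      then show ?thesis by (metis fun_upd_same)
    qed
    moreover have "\<exists>u\<in>D. (u, v) \<in> parcs G" if "f v = 0"
      using f(2)[OF v that] sym unfolding D_def by (auto dest: symD)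
    moreover have "f v \<in> {0, 1, 2}" using f(1) v by blast
    ultimately show "f v = rdf_of G D v" using v unfolding rdf_of_def D_def by auto
  qed
qed

lemma minimal_rdfs_eq: "minimal_rdfs G = rdf_of G ` (Pow (pverts G) \<inter> privileged (parcs G))"
proof
  show "minimal_rdfs G \<subseteq> rdf_of G ` (Pow (pverts G) \<inter> privileged (parcs G))"
  proof
    fix f assume "f \<in> minimal_rdfs G"
    then have "minimal_rdf G f" unfolding minimal_rdfs_def by simp
    from minimal_is_rdf_of[OF this]
    show "f \<in> rdf_of G ` (Pow (pverts G) \<inter> privileged (parcs G))" by auto
  qed
qed (use rdf_of_minimal in \<open>auto simp: minimal_rdfs_def\<close>)

lemma card_minimal_rdfs:
  "card (minimal_rdfs G) = card (Pow (pverts G) \<inter> privileged (parcs G))"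
  unfolding minimal_rdfs_eq by (rule card_image) (rule inj_on_subset[OF inj_on_rdf_of], blast)

end

section \<open>Running programs without output\<close>

text \<open>In silent runs, the length is all that matters for waiting times, and membership of all
  states in \<open>B\<close> carries the space bound along.\<close>

definition run :: "state set \<Rightarrow> com \<Rightarrow> nat \<Rightarrow> state \<Rightarrow> state \<Rightarrow> bool" where
  "run B c k s t \<longleftrightarrow>
     (\<exists>tr. exec c s tr t \<and> length tr \<le> k \<and> (\<forall>(out, s') \<in> set tr. out = None \<and> s' \<in> B))"

lemma run_mono: "run B c k s t \<Longrightarrow> k \<le> l \<Longrightarrow> run B c l s t"
  unfolding run_def by (meson order_trans)

lemma run_Assign:
  "s(x := (s x)(aval i s := aval e s)) \<in> B \<Longrightarrow>
     run B (Assign x i e) 1 s (s(x := (s x)(aval i s := aval e s)))"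
  unfolding run_def by (intro exI conjI, rule exec.Assign) auto

lemma run_Seq:
  assumes "run B c k s t" "run B d l t u"
  shows "run B (Seq c d) (k + l) s u"
proof -
  obtain tr tr' where "exec c s tr t" "exec d t tr' u" "length tr \<le> k" "length tr' \<le> l"
    "\<forall>(out, s') \<in> set tr \<union> set tr'. out = None \<and> s' \<in> B"
    using assms unfolding run_def by blast
  then show ?thesis
    unfolding run_def by (intro exI[of _ "tr @ tr'"]) (auto intro: exec.Seq)
qed

lemma run_If:
  assumes "s \<in> B" "run B (if bval b s then c else d) k s t"
  shows "run B (If b c d) (Suc k) s t"
proof -
  obtain tr where "exec (if bval b s then c else d) s tr t" "length tr \<le> k"
    "\<forall>(out, s') \<in> set tr. out = None \<and> s' \<in> B"
    using assms(2) unfolding run_def by blast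
  then show ?thesis
    using assms(1) unfolding run_def
    by (intro exI[of _ "(None, s) # tr"]) (auto intro: exec.IfTrue exec.IfFalse split: if_splits)
qed

lemma run_WhileFalse: "s \<in> B \<Longrightarrow> \<not> bval b s \<Longrightarrow> run B (While b c) 1 s s"
  unfolding run_def by (intro exI conjI, rule exec.WhileFalse) auto

lemma run_WhileTrue:
  assumes "s \<in> B" "bval b s" "run B c k s t" "run B (While b c) l t u"
  shows "run B (While b c) (Suc k + l) s u"
proof -
  obtain tr tr' where "exec c s tr t" "exec (While b c) t tr' u" "length tr \<le> k" "length tr' \<le> l"
    "\<forall>(out, s') \<in> set tr \<union> set tr'. out = None \<and> s' \<in> B"
    using assms(3,4) unfolding run_def by blast
  then show ?thesis
    using assms(1,2) unfolding run_def
    by (intro exI[of _ "(None, s) # tr @ tr'"]) (auto intro: exec.WhileTrue)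
qed

abbreviation scalar :: "string \<Rightarrow> aexp" where
  "scalar x \<equiv> Cell x (Const 0)"

abbreviation set_scalar :: "string \<Rightarrow> nat \<Rightarrow> state \<Rightarrow> state" where
  "set_scalar x v s \<equiv> s(x := (s x)(0 := v))"

definition For :: "string \<Rightarrow> aexp \<Rightarrow> com \<Rightarrow> com" where
  "For x e c = Seq (Assign x (Const 0) (Const 0))
     (While (Less (scalar x) e) (Seq c (Assign x (Const 0) (Add (scalar x) (Const 1)))))"

text \<open>Each round costs the body, a test and an increment; the initialisation and the last test
  give the final 2. As the bound \<open>e\<close> is evaluated anew in each test, the invariant has
  to fix its value.\<close>

lemma run_For:
  assumes init: "I 0 (set_scalar x 0 s)"
    and inv: "\<And>j s. I j s \<Longrightarrow> s \<in> B \<and> s x 0 = j \<and> aval e s = N"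
    and step: "\<And>j s. j < N \<Longrightarrow> I j s \<Longrightarrow> \<exists>t. run B c k s t \<and> t x 0 = j \<and> I (Suc j) (set_scalar x (Suc j) t)"
  shows "\<exists>t. run B (For x e c) (N * (k + 2) + 2) s t \<and> I N t"
proof -
  let ?b = "Less (scalar x) e" and ?c = "Seq c (Assign x (Const 0) (Add (scalar x) (Const 1)))"
  have "\<exists>t. run B (While ?b ?c) ((N - j) * (k + 2) + 1) s t \<and> I N t" if "I j s" "j \<le> N" for j s
    using that
  proof (induction "N - j" arbitrary: j s)
    case 0
    then show ?case using inv[OF 0(2)] run_WhileFalse[of s B ?b ?c] by auto
  next
    case (Suc l)
    then have j: "j < N" by simp
    obtain t where t: "run B c k s t" "t x 0 = j" "I (Suc j) (set_scalar x (Suc j) t)"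
      using step[OF j Suc.prems(1)] by blast
    have "run B ?c (k + 1) s (set_scalar x (Suc j) t)"
      using run_Seq[OF t(1) run_Assign[of t x "Const 0" "Add (scalar x) (Const 1)"]] t(2) inv[OF t(3)]
      by simp
    moreover obtain u where u: "run B (While ?b ?c) ((N - Suc j) * (k + 2) + 1) (set_scalar x (Suc j) t) u" "I N u"
      using Suc.hyps(1)[OF _ t(3) Suc_leI[OF j]] Suc.hyps(2) by (metis Suc_diff_Suc j nat.inject)
    ultimately have "run B (While ?b ?c) (Suc (k + 1) + ((N - Suc j) * (k + 2) + 1)) s u"
      using inv[OF Suc.prems(1)] j by (intro run_WhileTrue) auto
    moreover have "N - j = Suc (N - Suc j)" using j by simp
    then have "Suc (k + 1) + ((N - Suc j) * (k + 2) + 1) = (N - j) * (k + 2) + 1"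
      by (simp only: mult_Suc)
    ultimately show ?case using u(2) by metis
  qed
  from this[OF init] obtain t where t: "run B (While ?b ?c) (N * (k + 2) + 1) (set_scalar x 0 s) t" "I N t"
    by auto
  have "run B (Assign x (Const 0) (Const 0)) 1 s (set_scalar x 0 s)"
    using run_Assign[of s x "Const 0" "Const 0" B] inv[OF init] by simp
  from run_Seq[OF this t(1)] t(2) show ?thesis
    unfolding For_def by (intro exI[of _ t]) simp
qed

section \<open>Waiting times, total time and space of traces\<close>

lemma waiting_times_silent:
  "\<forall>(out, s') \<in> set tr. out = None \<Longrightarrow> waiting_times k (tr @ tr') = waiting_times (k + length tr) tr'"
  by (induction tr arbitrary: k) auto

lemma outputs_silent: "\<forall>(out, s') \<in> set tr. out = None \<Longrightarrow> outputs (tr @ tr') = outputs tr'"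
  by (induction tr) auto

lemma length_waiting_times: "length (waiting_times k tr) = Suc (length (outputs tr))"
  by (induction k tr rule: waiting_times.induct) auto

lemma sum_list_waiting_times: "sum_list (waiting_times k tr) = k + length tr"
  by (induction k tr rule: waiting_times.induct) auto

text \<open>The waiting times sum up to the length of the trace, and there is one more of them than
  outputs. Hence the total time follows from the delay and the number of solutions.\<close>

lemma length_trace_le:
  assumes "\<forall>w \<in> set (waiting_times 0 tr). w \<le> W"
  shows "length tr \<le> Suc (length (outputs tr)) * W"
proof -
  have "sum_list (waiting_times 0 tr) \<le> length (waiting_times 0 tr) * W"
    using sum_list_mono[of "waiting_times 0 tr" "\<lambda>x. x" "\<lambda>_. W"] assms
    by (simp add: sum_list_triv)
  then show ?thesis by (simp add: length_waiting_times sum_list_waiting_times)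
qed

text \<open>One cap for indices and contents turns the space bound into an invariant of single
  assignments.\<close>

definition capped :: "string set \<Rightarrow> nat \<Rightarrow> state set" where
  "capped X b = {s. \<forall>x i. s x i \<noteq> 0 \<longrightarrow> x \<in> X \<and> i \<le> b \<and> s x i \<le> b}"

lemma capped_update:
  "s \<in> capped X b \<Longrightarrow> x \<in> X \<Longrightarrow> i \<le> b \<Longrightarrow> v \<le> b \<Longrightarrow> s(x := (s x)(i := v)) \<in> capped X b"
  unfolding capped_def by auto

text \<open>A linear estimate in place of the logarithm is enough, because the cap on all contents
  will be polynomial in the order of the graph.\<close>

lemma bits_le: "bits k \<le> Suc k"
proof -
  have "floor_log k \<le> k"
    using order_trans[OF less_imp_le[OF less_exp] floor_log_exp2_le] by (cases "k = 0") auto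
  then show ?thesis unfolding bits_def by simp
qed

lemma space_capped:
  assumes "s \<in> capped X b" "finite X"
  shows "space s \<le> card X * Suc b * (2 * Suc b)"
proof -
  have sub: "support s \<subseteq> X \<times> {..b}"
    using assms(1) unfolding support_def capped_def by auto
  have "bits i + bits (s x i) \<le> 2 * Suc b" if "(x, i) \<in> support s" for x i
    using that assms(1) bits_le[of i] bits_le[of "s x i"] unfolding support_def capped_def by fastforce
  then have "space s \<le> card (support s) * (2 * Suc b)"
    using sum_bounded_above[of "support s" "\<lambda>(x, i). bits i + bits (s x i)" "2 * Suc b"]
    unfolding space_def by auto
  also have "\<dots> \<le> card (X \<times> {..b}) * (2 * Suc b)"
    using sub assms(2) by (intro mult_right_mono card_mono) auto
  finally show ?thesis by (simp add: card_cartesian_product)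
qed

section \<open>The enumeration program\<close>

lemma privileged_subset: "D \<in> privileged E \<Longrightarrow> D' \<subseteq> D \<Longrightarrow> D' \<in> privileged E"
  unfolding privileged_def private_nbr_def by blast

text \<open>Besides the four input arrays: \<open>d\<close> is the characteristic vector of
  \<open>D\<close>, \<open>c\<close> counts neighbours in \<open>D\<close>, \<open>p\<close> counts
  private neighbours, \<open>f\<close> holds the output, \<open>i\<close> is the position of the
  search, \<open>k\<close> a loop counter, \<open>g\<close> tells whether a set was found, and
  \<open>b\<close> counts violations.\<close>

definition array_names :: "string set" where
  "array_names = {''n'', ''m'', ''src'', ''tgt'', ''d'', ''c'', ''p'', ''f'', ''i'', ''k'', ''g'', ''b''}"

text \<open>For every vertex \<open>v\<close>, the sum over its neighbours \<open>u\<close> of the contribution of the arc \<open>(u, v)\<close>,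
  given by \<open>e\<close> for \<open>(src[k], tgt[k])\<close> and by \<open>e'\<close> for \<open>(tgt[k], src[k])\<close>.\<close>

definition accumulate :: "string \<Rightarrow> aexp \<Rightarrow> aexp \<Rightarrow> com" where
  "accumulate x e e' = Seq
     (For ''k'' (scalar ''n'') (Assign x (scalar ''k'') (Const 0)))
     (For ''k'' (scalar ''m'') (Seq
       (Assign x (Cell ''tgt'' (scalar ''k'')) (Add (Cell x (Cell ''tgt'' (scalar ''k''))) e))
       (Assign x (Cell ''src'' (scalar ''k'')) (Add (Cell x (Cell ''src'' (scalar ''k''))) e'))))"

text \<open>The cap \<open>b\<close> has to cover counters up to \<open>n\<close> and
  \<open>length es\<close>, sums up to \<open>n + 1\<close>, and the output value 2.\<close>

locale edge_list =
  fixes n :: nat and es :: "(nat \<times> nat) list" and E :: "(nat \<times> nat) set" and b :: nat and B :: "state set"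
  assumes distinct: "distinct es" and antisym: "set es \<inter> (set es)\<inverse> = {}"
    and E: "E = set es \<union> (set es)\<inverse>" and verts: "E \<subseteq> {..<n} \<times> {..<n}"
    and b: "n + 2 \<le> b" "length es \<le> b"
  defines "B \<equiv> capped array_names b"
begin

definition input :: "state \<Rightarrow> bool" where
  "input s \<longleftrightarrow> s \<in> B \<and> s ''n'' 0 = n \<and> s ''m'' 0 = length es \<and>
     (\<forall>j<length es. s ''src'' j = fst (es ! j) \<and> s ''tgt'' j = snd (es ! j))"

lemma input_cong: "input s \<Longrightarrow> t \<in> B \<Longrightarrow> \<forall>y \<in> {''n'', ''m'', ''src'', ''tgt''}. t y = s y \<Longrightarrow> input t"
  unfolding input_def by simp

lemma B_update:
  "s \<in> B \<Longrightarrow> x \<in> array_names \<Longrightarrow> i \<le> b \<Longrightarrow> v \<le> b \<Longrightarrow> s(x := (s x)(i := v)) \<in> B"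
  unfolding B_def by (rule capped_update)

lemma edge_verts: "j < length es \<Longrightarrow> fst (es ! j) < n \<and> snd (es ! j) < n \<and> fst (es ! j) \<noteq> snd (es ! j)"
proof -
  assume "j < length es"
  then obtain a c where "es ! j = (a, c)" "(a, c) \<in> set es" by (metis nth_mem prod.collapse)
  then show ?thesis using verts antisym unfolding E by auto
qed

definition edges_upto :: "nat \<Rightarrow> (nat \<times> nat) set" where
  "edges_upto j = set (take j es) \<union> (set (take j es))\<inverse>"

text \<open>Since an edge is listed once and in one orientation, neither of its arcs was processed
  before, and each of the two sums affected gains exactly one new term.\<close>

lemma edges_upto_Suc:
  assumes "j < length es"
  shows "edges_upto (Suc j) = edges_upto j \<union> {es ! j, (snd (es ! j), fst (es ! j))}"
    and "es ! j \<notin> edges_upto j" "(snd (es ! j), fst (es ! j)) \<notin> edges_upto j"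
proof -
  have t: "set (take (Suc j) es) = insert (es ! j) (set (take j es))"
    using assms by (simp add: take_Suc_conv_app_nth)
  then show "edges_upto (Suc j) = edges_upto j \<union> {es ! j, (snd (es ! j), fst (es ! j))}"
    unfolding edges_upto_def by (cases "es ! j") auto
  have "es ! j \<notin> set (take j es)"
    using assms distinct by (auto simp: in_set_conv_nth nth_eq_iff_index_eq)
  moreover have "es ! j \<notin> (set (take j es))\<inverse>"
    using antisym assms nth_mem[OF assms] set_take_subset[of j es] by (cases "es ! j") auto
  ultimately show "es ! j \<notin> edges_upto j" "(snd (es ! j), fst (es ! j)) \<notin> edges_upto j"
    unfolding edges_upto_def by (cases "es ! j"; auto)+
qed

lemma edges_upto_verts: "edges_upto j \<subseteq> {..<n} \<times> {..<n}"
  using verts set_take_subset[of j es] unfolding edges_upto_def E by blast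

lemma finite_in_nbrs: "finite {u. (u, v) \<in> edges_upto j}"
  using edges_upto_verts by (rule_tac finite_subset[of _ "{..<n}"]) auto

lemma in_sum_le:
  assumes "\<And>u. g u \<le> (1::nat)"
  shows "(\<Sum>u | (u, v) \<in> edges_upto j. g u) \<le> n"
proof -
  have "(\<Sum>u | (u, v) \<in> edges_upto j. g u) \<le> (\<Sum>u | (u, v) \<in> edges_upto j. 1)"
    using assms by (intro sum_mono)
  also have "\<dots> = card {u. (u, v) \<in> edges_upto j}" by simp
  also have "\<dots> \<le> card {..<n}" by (rule card_mono) (use edges_upto_verts in auto)
  finally show ?thesis by simp
qed

text \<open>The hypothesis on \<open>e\<close> and \<open>e'\<close> makes their values independent
  of the array \<open>x\<close>: the second assignment of a round is executed after the first has
  changed \<open>x\<close>.\<close>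

lemma run_accumulate:
  assumes s: "input s" and x: "x \<in> {''c'', ''p''}" and g: "\<And>u v. g u v \<le> (1::nat)"
    and e: "\<And>t j. \<forall>y. y \<noteq> x \<longrightarrow> y \<noteq> ''k'' \<longrightarrow> t y = s y \<Longrightarrow> j < length es \<Longrightarrow> t ''k'' 0 = j \<Longrightarrow>
      aval e t = g (fst (es ! j)) (snd (es ! j)) \<and> aval e' t = g (snd (es ! j)) (fst (es ! j))"
  shows "\<exists>t. run B (accumulate x e e') (3 * n + 4 * length es + 4) s t \<and> t \<in> B \<and>
    (\<forall>y. y \<noteq> x \<longrightarrow> y \<noteq> ''k'' \<longrightarrow> t y = s y) \<and> (\<forall>v<n. t x v = (\<Sum>u | (u, v) \<in> E. g u v))"
proof -
  have array_names: "x \<in> array_names" "''k'' \<in> array_names" "x \<noteq> ''k''" and io: "x \<noteq> ''n''" "x \<noteq> ''m''" "x \<noteq> ''src''" "x \<noteq> ''tgt''"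
    using x unfolding array_names_def by auto
  have sB: "s \<in> B" and inp: "s ''n'' 0 = n" "s ''m'' 0 = length es"
    "\<And>j. j < length es \<Longrightarrow> s ''src'' j = fst (es ! j) \<and> s ''tgt'' j = snd (es ! j)"
    using s unfolding input_def by auto
  define same where "same t \<longleftrightarrow> t \<in> B \<and> (\<forall>y. y \<noteq> x \<longrightarrow> y \<noteq> ''k'' \<longrightarrow> t y = s y)" for t :: state
  have same_k: "same (set_scalar ''k'' j t)" if "same t" "j \<le> b" for t j
    using that B_update[of t "''k''" 0 j] array_names unfolding same_def by simp
  have same_x: "same (t(x := (t x)(i := v)))" if "same t" "i \<le> b" "v \<le> b" for t i v
    using that B_update[of t x i v] array_names unfolding same_def by simp
  have same_inp: "t ''n'' 0 = n" "t ''m'' 0 = length es"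
    "\<And>j. j < length es \<Longrightarrow> t ''src'' j = fst (es ! j) \<and> t ''tgt'' j = snd (es ! j)" if "same t" for t
    using that inp io unfolding same_def by simp_all
  define I where "I j t \<longleftrightarrow> same t \<and> t ''k'' 0 = j \<and> j \<le> n \<and> (\<forall>v<j. t x v = 0)" for j and t :: state
  have "\<exists>t. run B (For ''k'' (scalar ''n'') (Assign x (scalar ''k'') (Const 0))) (n * (1 + 2) + 2) s t \<and> I n t"
  proof (rule run_For)
    show "I 0 (set_scalar ''k'' 0 s)"
      using same_k[of s 0] sB unfolding I_def same_def by simp
    show "t \<in> B \<and> t ''k'' 0 = j \<and> aval (scalar ''n'') t = n" if "I j t" for j t
      using that same_inp unfolding I_def same_def by simp
  next
    fix j t assume j: "j < n" and t: "I j t"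
    define u where "u = t(x := (t x)(j := 0))"
    have u: "same u" "u ''k'' 0 = j"
      using same_x[of t j 0] t j b array_names unfolding u_def I_def by auto
    moreover have "run B (Assign x (scalar ''k'') (Const 0)) 1 t u"
      using run_Assign[of t x "scalar ''k''" "Const 0" B] t u(1) unfolding u_def I_def same_def by simp
    moreover have "I (Suc j) (set_scalar ''k'' (Suc j) u)"
      using same_k[OF u(1), of "Suc j"] j b array_names t unfolding I_def u_def by (auto simp: less_Suc_eq)
    ultimately show "\<exists>u. run B (Assign x (scalar ''k'') (Const 0)) 1 t u \<and> u ''k'' 0 = j \<and>
        I (Suc j) (set_scalar ''k'' (Suc j) u)" by blast
  qed
  then obtain s1 where s1: "run B (For ''k'' (scalar ''n'') (Assign x (scalar ''k'') (Const 0))) (n * (1 + 2) + 2) s s1" "I n s1"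
    by blast
  define J where "J j t \<longleftrightarrow> same t \<and> t ''k'' 0 = j \<and> j \<le> length es \<and>
      (\<forall>v<n. t x v = (\<Sum>u | (u, v) \<in> edges_upto j. g u v))" for j and t :: state
  let ?c = "Seq
       (Assign x (Cell ''tgt'' (scalar ''k'')) (Add (Cell x (Cell ''tgt'' (scalar ''k''))) e))
       (Assign x (Cell ''src'' (scalar ''k'')) (Add (Cell x (Cell ''src'' (scalar ''k''))) e'))"
  have "\<exists>t. run B (For ''k'' (scalar ''m'') ?c) (length es * ((1 + 1) + 2) + 2) s1 t \<and> J (length es) t"
  proof (rule run_For)
    show "J 0 (set_scalar ''k'' 0 s1)"
      using same_k[of s1 0] s1(2) array_names unfolding I_def J_def edges_upto_def by simp
    show "t \<in> B \<and> t ''k'' 0 = j \<and> aval (scalar ''m'') t = length es" if "J j t" for j t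
      using that same_inp unfolding J_def same_def by simp
  next
    fix j t assume j: "j < length es" and t: "J j t"
    define a c where ac: "a = fst (es ! j)" "c = snd (es ! j)"
    have ac_less: "a < n" "c < n" "a \<noteq> c" using edge_verts[OF j] unfolding ac by auto
    have st: "same t" "t ''k'' 0 = j" using t unfolding J_def by auto
    have tx: "t x v = (\<Sum>u | (u, v) \<in> edges_upto j. g u v)" if "v < n" for v
      using t that unfolding J_def by simp
    \<comment> \<open>A vertex has at most \<open>n\<close> neighbours and each contributes at most
      1, so the sum with one further term stays below the cap.\<close>
    have le: "t x v + g u v \<le> b" if "v < n" for u v
      using tx[OF that] in_sum_le[of "\<lambda>u. g u v" v j] g[of u v] g b by fastforce
    define t1 where "t1 = t(x := (t x)(c := t x c + g a c))"
    define t2 where "t2 = t1(x := (t1 x)(a := t1 x a + g c a))"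
    have t1: "same t1" "t1 ''k'' 0 = j"
      using same_x[OF st(1)] le ac_less b st(2) array_names unfolding t1_def by auto
    have t2: "same t2" "t2 ''k'' 0 = j"
      using same_x[OF t1(1), of a "t1 x a + g c a"] le[of a c] ac_less b t1(2) array_names
      unfolding t2_def by (auto simp: t1_def)
    have "run B (Assign x (Cell ''tgt'' (scalar ''k'')) (Add (Cell x (Cell ''tgt'' (scalar ''k''))) e)) 1 t t1"
      using run_Assign[of t x "Cell ''tgt'' (scalar ''k'')" "Add (Cell x (Cell ''tgt'' (scalar ''k''))) e" B]
        e[of t j] st t1(1) j same_inp(3)[OF st(1) j] unfolding t1_def same_def ac by simp
    moreover have "run B (Assign x (Cell ''src'' (scalar ''k'')) (Add (Cell x (Cell ''src'' (scalar ''k''))) e')) 1 t1 t2"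
      using run_Assign[of t1 x "Cell ''src'' (scalar ''k'')" "Add (Cell x (Cell ''src'' (scalar ''k''))) e'" B]
        e[of t1 j] t1 t2(1) j same_inp(3)[OF t1(1) j] unfolding t2_def same_def ac by simp
    ultimately have "run B ?c (1 + 1) t t2" by (rule run_Seq)
    moreover have "J (Suc j) (set_scalar ''k'' (Suc j) t2)"
    proof -
      have up: "edges_upto (Suc j) = edges_upto j \<union> {(a, c), (c, a)}" "(a, c) \<notin> edges_upto j" "(c, a) \<notin> edges_upto j"
        using edges_upto_Suc[OF j] unfolding ac by simp_all
      have "t2 x v = (\<Sum>u | (u, v) \<in> edges_upto (Suc j). g u v)" if v: "v < n" for v
      proof -
        consider "v = a" | "v = c" | "v \<noteq> a" "v \<noteq> c" by blast
        then show ?thesis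
        proof cases
          case 1
          then have "{u. (u, v) \<in> edges_upto (Suc j)} = insert c {u. (u, v) \<in> edges_upto j}"
            using up ac_less by auto
          then show ?thesis
            using 1 up ac_less finite_in_nbrs tx unfolding t2_def t1_def by (simp add: add.commute)
        next
          case 2
          then have "{u. (u, v) \<in> edges_upto (Suc j)} = insert a {u. (u, v) \<in> edges_upto j}"
            using up ac_less by auto
          then show ?thesis
            using 2 up ac_less finite_in_nbrs tx unfolding t2_def t1_def by (simp add: add.commute)
        next
          case 3
          then have "{u. (u, v) \<in> edges_upto (Suc j)} = {u. (u, v) \<in> edges_upto j}"
            using up by auto
          then show ?thesis using 3 tx v unfolding t2_def t1_def by simp
        qed
      qed
      then show ?thesis
        using same_k[OF t2(1), of "Suc j"] j b array_names unfolding J_def by auto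
    qed
    ultimately show "\<exists>u. run B ?c (1 + 1) t u \<and> u ''k'' 0 = j \<and> J (Suc j) (set_scalar ''k'' (Suc j) u)"
      using t2(2) by blast
  qed
  then obtain s2 where s2: "run B (For ''k'' (scalar ''m'') ?c) (length es * ((1 + 1) + 2) + 2) s1 s2" "J (length es) s2"
    by blast
  have "edges_upto (length es) = E" unfolding edges_upto_def E by simp
  then have "s2 \<in> B" "\<forall>y. y \<noteq> x \<longrightarrow> y \<noteq> ''k'' \<longrightarrow> s2 y = s y" "\<forall>v<n. s2 x v = (\<Sum>u | (u, v) \<in> E. g u v)"
    using s2(2) unfolding J_def same_def by auto
  moreover have "run B (accumulate x e e') (3 * n + 4 * length es + 4) s s2"
    using run_Seq[OF s1(1) s2(1)] unfolding accumulate_def by (rule run_mono) simp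
  ultimately show ?thesis by blast
qed

end

definition count :: com where
  "count = accumulate ''c'' (Cell ''d'' (Cell ''src'' (scalar ''k''))) (Cell ''d'' (Cell ''tgt'' (scalar ''k'')))"

text \<open>
  In natural numbers, this is 1 if \<open>y \<in> D\<close> has the neighbour \<open>x\<close> as a private one, and 0 otherwise, provided that
  \<open>c[x]\<close> is the number of neighbours of \<open>x\<close> in \<open>D\<close>.
\<close>

definition flag_term :: "string \<Rightarrow> string \<Rightarrow> aexp" where
  "flag_term x y = Sub (Sub (Cell ''d'' (Cell y (scalar ''k''))) (Cell ''d'' (Cell x (scalar ''k''))))
     (Sub (Cell ''c'' (Cell x (scalar ''k''))) (Const 1))"

text \<open>By truncated subtraction, \<open>d[v] - p[v]\<close> is 1 if \<open>v\<close> is in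
  \<open>D\<close> without private neighbour and 0 otherwise, so that \<open>b\<close> counts the
  violations.\<close>

definition check :: com where
  "check = Seq count (Seq (accumulate ''p'' (flag_term ''src'' ''tgt'') (flag_term ''tgt'' ''src''))
     (Seq (Assign ''b'' (Const 0) (Const 0))
       (For ''k'' (scalar ''n'') (Assign ''b'' (Const 0)
         (Add (scalar ''b'') (Sub (Cell ''d'' (scalar ''k'')) (Cell ''p'' (scalar ''k''))))))))"

text \<open>\<open>d + d\<close> gives 2 on \<open>D\<close>; the truncated \<open>1 - d - c\<close>
  gives 1 exactly on the vertices outside \<open>D\<close> without neighbour in
  \<open>D\<close>.\<close>

definition write_rdf :: com where
  "write_rdf = Seq count (For ''k'' (scalar ''n'') (Assign ''f'' (scalar ''k'')
     (Add (Add (Cell ''d'' (scalar ''k'')) (Cell ''d'' (scalar ''k'')))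
       (Sub (Sub (Const 1) (Cell ''d'' (scalar ''k''))) (Cell ''c'' (scalar ''k''))))))"

text \<open>A search like that of an odometer: positions passed on the way down are cleared, so the
  candidate at position \<open>i\<close> keeps only the smaller members of the old set. If the
  search fails everywhere, \<open>g\<close> remains 0 and ends the main loop.\<close>

definition advance :: com where
  "advance = While (And (Eq (scalar ''g'') (Const 0)) (Less (Const 0) (scalar ''i'')))
     (Seq (Assign ''i'' (Const 0) (Sub (scalar ''i'') (Const 1)))
       (If (Eq (Cell ''d'' (scalar ''i'')) (Const 1))
         (Assign ''d'' (scalar ''i'') (Const 0))
         (Seq (Assign ''d'' (scalar ''i'') (Const 1))
           (Seq check
             (If (Eq (scalar ''b'') (Const 0))
               (Assign ''g'' (Const 0) (Const 1))
               (Assign ''d'' (scalar ''i'') (Const 0)))))))"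

context edge_list
begin

definition repr :: "nat set \<Rightarrow> state \<Rightarrow> bool" where
  "repr D s \<longleftrightarrow> input s \<and> D \<subseteq> {..<n} \<and> (\<forall>v. s ''d'' v = of_bool (v \<in> D))"

lemma repr_cong:
  "repr D s \<Longrightarrow> t \<in> B \<Longrightarrow> \<forall>y \<in> {''n'', ''m'', ''src'', ''tgt'', ''d''}. t y = s y \<Longrightarrow> repr D t"
  unfolding repr_def using input_cong[of s t] by simp

lemma repr_B: "repr D s \<Longrightarrow> s \<in> B"
  unfolding repr_def input_def by simp

lemma input_scalar: "input s \<Longrightarrow> s ''n'' 0 = n" "input s \<Longrightarrow> s ''m'' 0 = length es"
  "input s \<Longrightarrow> j < length es \<Longrightarrow> s ''src'' j = fst (es ! j)"
  "input s \<Longrightarrow> j < length es \<Longrightarrow> s ''tgt'' j = snd (es ! j)"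
  unfolding input_def by auto

lemma finite_E_nbrs: "finite {u. (u, v) \<in> E}"
  using verts by (rule_tac finite_subset[of _ "{..<n}"]) auto

lemma symE: "sym E"
  unfolding E by (auto simp: sym_def)

definition nbr_count :: "nat set \<Rightarrow> nat \<Rightarrow> nat" where
  "nbr_count D v = card {u \<in> D. (u, v) \<in> E}"

lemma nbr_count_sum: "nbr_count D v = (\<Sum>u | (u, v) \<in> E. of_bool (u \<in> D))"
  unfolding nbr_count_def using finite_E_nbrs
  by (simp add: of_bool_def sum.If_cases Collect_conj_eq Int_commute)

lemma run_count:
  assumes "repr D s"
  shows "\<exists>t. run B count (3 * n + 4 * length es + 4) s t \<and> repr D t \<and>
    (\<forall>y. y \<noteq> ''c'' \<longrightarrow> y \<noteq> ''k'' \<longrightarrow> t y = s y) \<and> (\<forall>v<n. t ''c'' v = nbr_count D v)"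
proof -
  have "\<exists>t. run B count (3 * n + 4 * length es + 4) s t \<and> t \<in> B \<and>
    (\<forall>y. y \<noteq> ''c'' \<longrightarrow> y \<noteq> ''k'' \<longrightarrow> t y = s y) \<and> (\<forall>v<n. t ''c'' v = (\<Sum>u | (u, v) \<in> E. of_bool (u \<in> D)))"
    unfolding count_def
  proof (rule run_accumulate)
    show "input s" using assms unfolding repr_def by simp
    fix t j assume *: "\<forall>y. y \<noteq> ''c'' \<longrightarrow> y \<noteq> ''k'' \<longrightarrow> t y = s y" "j < length es" "t ''k'' 0 = j"
    then show "aval (Cell ''d'' (Cell ''src'' (scalar ''k''))) t = of_bool (fst (es ! j) \<in> D) \<and>
        aval (Cell ''d'' (Cell ''tgt'' (scalar ''k''))) t = of_bool (snd (es ! j) \<in> D)"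
      using assms input_scalar(3,4)[of s j] unfolding repr_def by simp
  qed simp_all
  then obtain t where t: "run B count (3 * n + 4 * length es + 4) s t" "t \<in> B"
    "\<forall>y. y \<noteq> ''c'' \<longrightarrow> y \<noteq> ''k'' \<longrightarrow> t y = s y"
    "\<forall>v<n. t ''c'' v = (\<Sum>u | (u, v) \<in> E. of_bool (u \<in> D))"
    by blast
  moreover have "repr D t" using repr_cong[OF assms t(2)] t(3) by simp
  ultimately show ?thesis unfolding nbr_count_sum by (intro exI[of _ t] conjI)
qed

text \<open>For \<open>v\<close> in \<open>D\<close>, each neighbour \<open>u\<close> has at least
  one neighbour in \<open>D\<close>, namely \<open>v\<close>. So
  \<open>nbr_count D u \<le> 1\<close> says that \<open>v\<close> is the only one, and the truncated
  term is 1 precisely for the private neighbours.\<close>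

lemma privileged_iff_flags:
  assumes D: "D \<subseteq> {..<n}"
  shows "D \<in> privileged E \<longleftrightarrow>
    (\<forall>v\<in>D. 0 < (\<Sum>u | (u, v) \<in> E. of_bool (v \<in> D) - of_bool (u \<in> D) - (nbr_count D u - 1)))"
proof -
  have "(0 < (\<Sum>u | (u, v) \<in> E. of_bool (v \<in> D) - of_bool (u \<in> D) - (nbr_count D u - 1))) \<longleftrightarrow>
      (\<exists>x. private_nbr E D v x)" if v: "v \<in> D" for v
  proof -
    have "private_nbr E D v u \<longleftrightarrow> u \<notin> D \<and> nbr_count D u \<le> 1" if u: "(u, v) \<in> E" for u
    proof -
      have vu: "(v, u) \<in> E" using u symE by (auto dest: symD)
      have "finite {w \<in> D. (w, u) \<in> E}" using D finite_subset by fastforce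
      then have "nbr_count D u \<le> 1 \<longleftrightarrow> (\<forall>w\<in>D. (w, u) \<in> E \<longrightarrow> w = v)"
        unfolding nbr_count_def using v vu by (auto simp: card_le_Suc0_iff_eq)
      then show ?thesis using vu unfolding private_nbr_def by blast
    qed
    moreover have "(u, v) \<in> E" if "private_nbr E D v u" for u
      using that symE unfolding private_nbr_def by (auto dest: symD)
    ultimately have "(\<exists>x. private_nbr E D v x) \<longleftrightarrow> (\<exists>u. (u, v) \<in> E \<and> u \<notin> D \<and> nbr_count D u \<le> 1)"
      by blast
    then show ?thesis using v finite_E_nbrs by (auto simp: sum_pos2 neq0_conv[symmetric] simp del: neq0_conv)
  qed
  then show ?thesis unfolding privileged_def by simp
qed

lemma run_check:
  assumes "repr D s"
  shows "\<exists>t. run B check (9 * n + 8 * length es + 11) s t \<and> repr D t \<and>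
    (\<forall>y \<in> {''i'', ''g''}. t y = s y) \<and> (t ''b'' 0 = 0 \<longleftrightarrow> D \<in> privileged E)"
proof -
  obtain s1 where s1: "run B count (3 * n + 4 * length es + 4) s s1" "repr D s1"
    "\<forall>y. y \<noteq> ''c'' \<longrightarrow> y \<noteq> ''k'' \<longrightarrow> s1 y = s y" "\<forall>v<n. s1 ''c'' v = nbr_count D v"
    using run_count[OF assms] by blast
  define g where "g u v = of_bool (v \<in> D) - of_bool (u \<in> D) - (nbr_count D u - 1)" for u v
  have "\<exists>t. run B (accumulate ''p'' (flag_term ''src'' ''tgt'') (flag_term ''tgt'' ''src''))
      (3 * n + 4 * length es + 4) s1 t \<and> t \<in> B \<and>
      (\<forall>y. y \<noteq> ''p'' \<longrightarrow> y \<noteq> ''k'' \<longrightarrow> t y = s1 y) \<and> (\<forall>v<n. t ''p'' v = (\<Sum>u | (u, v) \<in> E. g u v))"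
  proof (rule run_accumulate)
    show "input s1" using s1(2) unfolding repr_def by simp
    show "g u v \<le> 1" for u v unfolding g_def by simp
    fix t j assume *: "\<forall>y. y \<noteq> ''p'' \<longrightarrow> y \<noteq> ''k'' \<longrightarrow> t y = s1 y" "j < length es" "t ''k'' 0 = j"
    then show "aval (flag_term ''src'' ''tgt'') t = g (fst (es ! j)) (snd (es ! j)) \<and>
        aval (flag_term ''tgt'' ''src'') t = g (snd (es ! j)) (fst (es ! j))"
      using s1(2,4) input_scalar(3,4)[of s1 j] edge_verts[of j]
      unfolding repr_def flag_term_def g_def by simp
  qed simp
  then obtain s2 where s2: "run B (accumulate ''p'' (flag_term ''src'' ''tgt'') (flag_term ''tgt'' ''src''))
      (3 * n + 4 * length es + 4) s1 s2" "s2 \<in> B"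
      "\<forall>y. y \<noteq> ''p'' \<longrightarrow> y \<noteq> ''k'' \<longrightarrow> s2 y = s1 y" "\<forall>v<n. s2 ''p'' v = (\<Sum>u | (u, v) \<in> E. g u v)"
    by blast
  define flag where "flag v = (\<Sum>u | (u, v) \<in> E. g u v)" for v
  have r2: "repr D s2" using repr_cong[OF s1(2) s2(2)] s2(3) by simp
  define s3 where "s3 = set_scalar ''b'' 0 s2"
  have s3: "s3 \<in> B" "repr D s3"
  proof -
    show "s3 \<in> B" unfolding s3_def using B_update[OF s2(2), of "''b''" 0 0] by (simp add: array_names_def)
    then show "repr D s3" by (rule repr_cong[OF r2]) (simp add: s3_def)
  qed
  have run3: "run B (Assign ''b'' (Const 0) (Const 0)) 1 s2 s3"
    using run_Assign[of s2 "''b''" "Const 0" "Const 0" B] s3(1) unfolding s3_def by simp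
  define J where "J j t \<longleftrightarrow> repr D t \<and> t ''k'' 0 = j \<and> j \<le> n \<and> (\<forall>y \<in> {''i'', ''g'', ''p''}. t y = s3 y) \<and>
     t ''b'' 0 = (\<Sum>v<j. of_bool (v \<in> D) - flag v)" for j and t :: state
  let ?c = "Assign ''b'' (Const 0) (Add (scalar ''b'') (Sub (Cell ''d'' (scalar ''k'')) (Cell ''p'' (scalar ''k''))))"
  have "\<exists>t. run B (For ''k'' (scalar ''n'') ?c) (n * (1 + 2) + 2) s3 t \<and> J n t"
  proof (rule run_For)
    have "set_scalar ''k'' 0 s3 \<in> B" using B_update[OF s3(1), of "''k''" 0 0] by (simp add: array_names_def)
    then have "repr D (set_scalar ''k'' 0 s3)" by (rule repr_cong[OF s3(2)]) simp
    then show "J 0 (set_scalar ''k'' 0 s3)" unfolding J_def s3_def by simp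
    show "t \<in> B \<and> t ''k'' 0 = j \<and> aval (scalar ''n'') t = n" if "J j t" for j t
      using that repr_B unfolding J_def repr_def by (auto simp: input_scalar)
  next
    fix j t assume j: "j < n" and t: "J j t"
    define u where "u = set_scalar ''b'' (\<Sum>v<Suc j. of_bool (v \<in> D) - flag v) t"
    have le: "(\<Sum>v<Suc j. of_bool (v \<in> D) - flag v) \<le> b"
    proof -
      have "(\<Sum>v<Suc j. of_bool (v \<in> D) - flag v) \<le> (\<Sum>v<Suc j. 1)" by (intro sum_mono) simp
      then show ?thesis using j b by simp
    qed
    have tB: "t \<in> B" "repr D t" using t repr_B unfolding J_def by auto
    have uB: "u \<in> B" unfolding u_def using B_update[OF tB(1), of "''b''" 0] le by (simp add: array_names_def)
    then have ru: "repr D u" by (rule repr_cong[OF tB(2)]) (simp add: u_def)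
    have "t ''p'' j = flag j" using t j s2(4) unfolding J_def s3_def flag_def by simp
    then have "run B ?c 1 t u"
      using run_Assign[of t "''b''" "Const 0" "Add (scalar ''b'') (Sub (Cell ''d'' (scalar ''k'')) (Cell ''p'' (scalar ''k'')))" B]
        uB t tB(2) unfolding u_def J_def repr_def by simp
    moreover have "u ''k'' 0 = j" using t unfolding J_def u_def by simp
    moreover have "set_scalar ''k'' (Suc j) u \<in> B"
      using B_update[OF uB, of "''k''" 0 "Suc j"] j b by (simp add: array_names_def)
    then have "repr D (set_scalar ''k'' (Suc j) u)" by (rule repr_cong[OF ru]) simp
    then have "J (Suc j) (set_scalar ''k'' (Suc j) u)" using t j unfolding J_def u_def by simp
    ultimately show "\<exists>u. run B ?c 1 t u \<and> u ''k'' 0 = j \<and> J (Suc j) (set_scalar ''k'' (Suc j) u)" by blast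
  qed
  then obtain s4 where s4: "run B (For ''k'' (scalar ''n'') ?c) (n * (1 + 2) + 2) s3 s4" "J n s4" by blast
  have D: "D \<subseteq> {..<n}" using assms unfolding repr_def by simp
  have "s4 ''b'' 0 = 0 \<longleftrightarrow> (\<forall>v<n. of_bool (v \<in> D) \<le> flag v)"
    using s4(2) unfolding J_def by auto
  also have "\<dots> \<longleftrightarrow> (\<forall>v\<in>D. 0 < flag v)"
    using D by (auto simp: Suc_le_eq)
  also have "\<dots> \<longleftrightarrow> D \<in> privileged E"
    unfolding privileged_iff_flags[OF D] flag_def g_def ..
  finally have "s4 ''b'' 0 = 0 \<longleftrightarrow> D \<in> privileged E" .
  moreover have "run B check (9 * n + 8 * length es + 11) s s4"
    unfolding check_def
    by (rule run_mono[OF run_Seq[OF s1(1) run_Seq[OF s2(1) run_Seq[OF run3 s4(1)]]]]) simp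
  moreover have "repr D s4" "\<forall>y \<in> {''i'', ''g''}. s4 y = s y"
    using s4(2) s1(3) s2(3) unfolding J_def s3_def by auto
  ultimately show ?thesis by (intro exI[of _ s4] conjI)
qed

definition out :: "nat set \<Rightarrow> nat \<Rightarrow> nat" where
  "out D v = (if v \<in> D then 2 else if \<exists>u\<in>D. (u, v) \<in> E then 0 else 1)"

lemma run_write_rdf:
  assumes "repr D s"
  shows "\<exists>t. run B write_rdf (6 * n + 4 * length es + 6) s t \<and> repr D t \<and> (\<forall>v<n. t ''f'' v = out D v)"
proof -
  obtain s1 where s1: "run B count (3 * n + 4 * length es + 4) s s1" "repr D s1" "\<forall>v<n. s1 ''c'' v = nbr_count D v"
    using run_count[OF assms] by blast
  define J where "J j t \<longleftrightarrow> repr D t \<and> t ''k'' 0 = j \<and> j \<le> n \<and> t ''c'' = s1 ''c'' \<and> (\<forall>v<j. t ''f'' v = out D v)"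
    for j and t :: state
  let ?e = "Add (Add (Cell ''d'' (scalar ''k'')) (Cell ''d'' (scalar ''k'')))
       (Sub (Sub (Const 1) (Cell ''d'' (scalar ''k''))) (Cell ''c'' (scalar ''k'')))"
  have "\<exists>t. run B (For ''k'' (scalar ''n'') (Assign ''f'' (scalar ''k'') ?e)) (n * (1 + 2) + 2) s1 t \<and> J n t"
  proof (rule run_For)
    have "set_scalar ''k'' 0 s1 \<in> B" using B_update[OF repr_B[OF s1(2)], of "''k''" 0 0] by (simp add: array_names_def)
    then have "repr D (set_scalar ''k'' 0 s1)" by (rule repr_cong[OF s1(2)]) simp
    then show "J 0 (set_scalar ''k'' 0 s1)" unfolding J_def by simp
    show "t \<in> B \<and> t ''k'' 0 = j \<and> aval (scalar ''n'') t = n" if "J j t" for j t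
      using that repr_B unfolding J_def repr_def by (auto simp: input_scalar)
  next
    fix j t assume j: "j < n" and t: "J j t"
    define u where "u = t(''f'' := (t ''f'')(j := out D j))"
    have tB: "t \<in> B" "repr D t" using t repr_B unfolding J_def by auto
    have "out D j \<le> b" using b unfolding out_def by auto
    then have uB: "u \<in> B" unfolding u_def using B_update[OF tB(1), of "''f''" j] j b by (simp add: array_names_def)
    then have ru: "repr D u" by (rule repr_cong[OF tB(2)]) (simp add: u_def)
    have "finite {u \<in> D. (u, j) \<in> E}" using tB(2) unfolding repr_def by (auto intro: finite_subset)
    then have "nbr_count D j = 0 \<longleftrightarrow> \<not> (\<exists>u\<in>D. (u, j) \<in> E)" unfolding nbr_count_def by auto
    then have "aval ?e t = out D j"
      using t j s1(3) unfolding J_def repr_def out_def by auto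
    then have "run B (Assign ''f'' (scalar ''k'') ?e) 1 t u"
      using run_Assign[of t "''f''" "scalar ''k''" ?e B] uB t unfolding u_def J_def by simp
    moreover have "u ''k'' 0 = j" using t unfolding J_def u_def by simp
    moreover have "set_scalar ''k'' (Suc j) u \<in> B"
      using B_update[OF uB, of "''k''" 0 "Suc j"] j b by (simp add: array_names_def)
    then have "repr D (set_scalar ''k'' (Suc j) u)" by (rule repr_cong[OF ru]) simp
    then have "J (Suc j) (set_scalar ''k'' (Suc j) u)" using t j unfolding J_def u_def by (simp add: less_Suc_eq)
    ultimately show "\<exists>u. run B (Assign ''f'' (scalar ''k'') ?e) 1 t u \<and> u ''k'' 0 = j \<and> J (Suc j) (set_scalar ''k'' (Suc j) u)"
      by blast
  qed
  then obtain s2 where s2: "run B (For ''k'' (scalar ''n'') (Assign ''f'' (scalar ''k'') ?e)) (n * (1 + 2) + 2) s1 s2" "J n s2"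
    by blast
  have "run B write_rdf (6 * n + 4 * length es + 6) s s2"
    unfolding write_rdf_def by (rule run_mono[OF run_Seq[OF s1(1) s2(1)]]) simp
  then show ?thesis using s2(2) unfolding J_def by blast
qed

end

text \<open>Characteristic vectors are compared with vertex 0 as the most significant position: the
  smallest element in which the sets differ decides.\<close>

definition lex_less :: "nat set \<Rightarrow> nat set \<Rightarrow> bool" where
  "lex_less D D' \<longleftrightarrow> (\<exists>j. j \<in> D' \<and> j \<notin> D \<and> D' \<inter> {..<j} = D \<inter> {..<j})"

lemma lex_less_irrefl: "\<not> lex_less D D"
  unfolding lex_less_def by blast

lemma lex_less_empty:
  assumes "D \<noteq> {}"
  shows "lex_less {} D"
proof -
  define j where "j = (LEAST j. j \<in> D)"
  have "j \<in> D" using assms unfolding j_def by (metis LeastI ex_in_conv)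
  moreover have "D \<inter> {..<j} = {}" using not_less_Least unfolding j_def by blast
  ultimately show ?thesis unfolding lex_less_def by auto
qed

text \<open>If a member \<open>D'\<close> of \<open>F\<close> branches off from \<open>D\<close> at
  \<open>j\<close>, then \<open>insert j (D \<inter> {..<j})\<close> is a subset of
  \<open>D'\<close> and hence in \<open>F\<close>, so \<open>j \<le> i\<close> by the choice of
  \<open>i\<close>. For \<open>j = i\<close>, \<open>D'\<close> extends the claimed successor by
  larger elements only; for \<open>j < i\<close>, it branches off from the successor at
  \<open>j\<close> as well.\<close>

lemma lex_less_successor:
  assumes i: "i \<notin> D" and max: "\<And>l. i < l \<Longrightarrow> l \<notin> D \<Longrightarrow> insert l (D \<inter> {..<l}) \<notin> F"
    and her: "\<And>A A'. A \<in> F \<Longrightarrow> A' \<subseteq> A \<Longrightarrow> A' \<in> F" and D': "D' \<in> F"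
  shows "lex_less D D' \<longleftrightarrow> D' = insert i (D \<inter> {..<i}) \<or> lex_less (insert i (D \<inter> {..<i})) D'"
proof
  let ?S = "insert i (D \<inter> {..<i})"
  assume "lex_less D D'"
  then obtain j where j: "j \<in> D'" "j \<notin> D" "D' \<inter> {..<j} = D \<inter> {..<j}" unfolding lex_less_def by blast
  have "insert j (D \<inter> {..<j}) \<subseteq> D'" unfolding j(3)[symmetric] using j(1) by simp
  from her[OF D' this] have "\<not> i < j" using max[of j] j(2) by auto
  then consider "j = i" | "j < i" by linarith
  then show "D' = ?S \<or> lex_less ?S D'"
  proof cases
    case 1
    then have eq: "?S = insert i (D' \<inter> {..<i})" and iD': "i \<in> D'" using j by simp_all
    have sub: "?S \<subseteq> D'" "D' \<inter> {..i} = ?S" unfolding eq using iD' by (auto simp: le_less)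
    show ?thesis
    proof (cases "D' = ?S")
      case False
      define l where "l = (LEAST l. l \<in> D' - ?S)"
      have l: "l \<in> D' - ?S" using False sub(1) unfolding l_def by (metis LeastI Diff_eq_empty_iff ex_in_conv subset_antisym)
      then have "i < l" using sub(2) by (metis Diff_iff IntI atMost_iff not_le)
      moreover have "x \<notin> D' - ?S" if "x < l" for x using not_less_Least that unfolding l_def by blast
      ultimately have "D' \<inter> {..<l} = ?S \<inter> {..<l}" using sub(1) by blast
      then show ?thesis using l unfolding lex_less_def by blast
    qed blast
  next
    case 2
    then have "?S \<inter> {..<j} = D \<inter> {..<j}" "j \<notin> ?S" using j(2) by auto
    then have "D' \<inter> {..<j} = ?S \<inter> {..<j}" "j \<notin> ?S" using j(3) by simp_all
    then show ?thesis using j(1) unfolding lex_less_def by blast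
  qed
next
  let ?S = "insert i (D \<inter> {..<i})"
  assume "D' = ?S \<or> lex_less ?S D'"
  then show "lex_less D D'"
  proof
    assume "D' = ?S"
    then show ?thesis using i unfolding lex_less_def by (intro exI[of _ i]) auto
  next
    assume "lex_less ?S D'"
    then obtain j where j: "j \<in> D'" "j \<notin> ?S" "D' \<inter> {..<j} = ?S \<inter> {..<j}" unfolding lex_less_def by blast
    then have "j \<noteq> i" by blast
    then consider "j < i" | "i < j" by linarith
    then show ?thesis
    proof cases
      case 1
      then have "?S \<inter> {..<j} = D \<inter> {..<j}" "j \<notin> D" using j(2) by auto
      then have "j \<notin> D" "D' \<inter> {..<j} = D \<inter> {..<j}" using j(3) by simp_all
      then show ?thesis using j(1) unfolding lex_less_def by blast
    next
      case 2
      have eq: "D' \<inter> {..i} = D' \<inter> {..<j} \<inter> {..i}" using 2 by auto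
      have "D' \<inter> {..i} = ?S" unfolding eq j(3) using 2 by auto
      moreover have "D' \<inter> {..<i} = D' \<inter> {..i} \<inter> {..<i}" by auto
      ultimately have "i \<in> D'" "D' \<inter> {..<i} = ?S \<inter> {..<i}" by blast+
      moreover have "?S \<inter> {..<i} = D \<inter> {..<i}" by auto
      ultimately show ?thesis using i unfolding lex_less_def by metis
    qed
  qed
qed

definition enum_body :: com where
  "enum_body = Seq write_rdf (Seq (Output ''f'' (scalar ''n''))
     (Seq (Assign ''g'' (Const 0) (Const 0)) (Seq (Assign ''i'' (Const 0) (scalar ''n'')) advance)))"

text \<open>The initial memory represents the empty set, which is a solution, so the loop can start
  with an output.\<close>

definition enum_rdfs :: com where
  "enum_rdfs = Seq (Assign ''g'' (Const 0) (Const 1)) (While (Eq (scalar ''g'') (Const 1)) enum_body)"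

section \<open>Correctness, delay and space of the enumeration\<close>

context edge_list
begin

lemma repr_set_scalar:
  assumes "repr D s" "x \<in> {''i'', ''g''}" "v \<le> b"
  shows "repr D (set_scalar x v s)"
proof (rule repr_cong[OF assms(1)])
  show "set_scalar x v s \<in> B" using assms by (intro B_update repr_B) (auto simp: array_names_def)
qed (use assms(2) in auto)

lemma repr_set_d:
  assumes "repr D s" "l < n"
  shows "repr (insert l D) (s(''d'' := (s ''d'')(l := 1)))" "repr (D - {l}) (s(''d'' := (s ''d'')(l := 0)))"
proof -
  have "input (s(''d'' := (s ''d'')(l := v)))" if "v \<le> 1" for v
  proof (rule input_cong)
    show "input s" using assms(1) unfolding repr_def by simp
    show "s(''d'' := (s ''d'')(l := v)) \<in> B"
      using assms b that by (intro B_update repr_B) (auto simp: array_names_def)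
  qed simp
  then show "repr (insert l D) (s(''d'' := (s ''d'')(l := 1)))" "repr (D - {l}) (s(''d'' := (s ''d'')(l := 0)))"
    using assms unfolding repr_def by auto
qed

definition no_successor :: "nat set \<Rightarrow> nat \<Rightarrow> bool" where
  "no_successor D j \<longleftrightarrow> (\<forall>l. j \<le> l \<longrightarrow> l < n \<longrightarrow> l \<notin> D \<longrightarrow> insert l (D \<inter> {..<l}) \<notin> privileged E)"

lemma no_successor_Suc:
  "no_successor D (Suc j) \<Longrightarrow> j \<in> D \<or> insert j (D \<inter> {..<j}) \<notin> privileged E \<Longrightarrow> no_successor D j"
  unfolding no_successor_def by (metis le_antisym not_less_eq_eq)

text \<open>The memory holds only \<open>D \<inter> {..<j}\<close>; all of \<open>D\<close> survives
  in the proof alone. The 17 is the 11 of \<open>check\<close> plus the loop test, the decrement,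
  the first branching, the setting of \<open>d\<close>, and two steps to evaluate the
  result.\<close>

lemma run_advance:
  assumes "repr (D \<inter> {..<j}) s" "s ''i'' 0 = j" "s ''g'' 0 = 0" "j \<le> n" "no_successor D j"
  shows "\<exists>t. run B advance (j * (9 * n + 8 * length es + 17) + 1) s t \<and>
    (t ''g'' 0 = 0 \<and> t \<in> B \<and> no_successor D 0 \<or>
     t ''g'' 0 = 1 \<and> (\<exists>l<n. l \<notin> D \<and> insert l (D \<inter> {..<l}) \<in> privileged E \<and> no_successor D (Suc l) \<and>
       repr (insert l (D \<inter> {..<l})) t))"
  using assms
proof (induction j arbitrary: s)
  case 0
  then have "run B advance 1 s s"
    unfolding advance_def by (intro run_WhileFalse) (use repr_B in auto)
  then show ?case using 0 repr_B by auto
next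
  case (Suc l)
  let ?T = "9 * n + 8 * length es"
  have l: "l < n" "l \<le> b" using Suc.prems(4) b by auto
  \<comment> \<open>The counter is decremented before it is used: with \<open>i = Suc l\<close> the
    position tried is \<open>l\<close>, so starting at \<open>n\<close> tries \<open>n - 1\<close>
    first.\<close>
  define s1 where "s1 = set_scalar ''i'' l s"
  have s1: "repr (D \<inter> {..<Suc l}) s1" "s1 ''i'' 0 = l" "s1 ''g'' 0 = 0"
    using repr_set_scalar[OF Suc.prems(1)] l Suc.prems(3) unfolding s1_def by auto
  have run1: "run B (Assign ''i'' (Const 0) (Sub (scalar ''i'') (Const 1))) 1 s s1"
    using run_Assign[of s "''i''" "Const 0" "Sub (scalar ''i'') (Const 1)" B] repr_B[OF s1(1)] Suc.prems(2)
    unfolding s1_def by simp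
  let ?b = "And (Eq (scalar ''g'') (Const 0)) (Less (Const 0) (scalar ''i''))"
  let ?i2 = "If (Eq (scalar ''b'') (Const 0)) (Assign ''g'' (Const 0) (Const 1)) (Assign ''d'' (scalar ''i'') (Const 0))"
  let ?e = "Seq (Assign ''d'' (scalar ''i'') (Const 1)) (Seq check ?i2)"
  let ?i = "If (Eq (Cell ''d'' (scalar ''i'')) (Const 1)) (Assign ''d'' (scalar ''i'') (Const 0)) ?e"
  let ?c = "Seq (Assign ''i'' (Const 0) (Sub (scalar ''i'') (Const 1))) ?i"
  have s: "s \<in> B" "bval ?b s" using Suc.prems repr_B by auto
  have continue: ?case
    if run: "run B ?c (?T + 16) s t" and t: "repr (D \<inter> {..<l}) t" "t ''i'' 0 = l" "t ''g'' 0 = 0"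
      and no: "l \<in> D \<or> insert l (D \<inter> {..<l}) \<notin> privileged E" for t
  proof -
    obtain u where u: "run B advance (l * (?T + 17) + 1) t u"
      "u ''g'' 0 = 0 \<and> u \<in> B \<and> no_successor D 0 \<or>
     u ''g'' 0 = 1 \<and> (\<exists>l<n. l \<notin> D \<and> insert l (D \<inter> {..<l}) \<in> privileged E \<and> no_successor D (Suc l) \<and>
       repr (insert l (D \<inter> {..<l})) u)"
      using Suc.IH[OF t] l(1) no_successor_Suc[OF Suc.prems(5) no] by auto
    have "run B advance (Suc (?T + 16) + (l * (?T + 17) + 1)) s u"
      unfolding advance_def
      by (rule run_WhileTrue[OF s run u(1)[unfolded advance_def]])
    then have "run B advance (Suc l * (?T + 17) + 1) s u" by (rule run_mono) simp
    then show ?thesis using u(2) by blast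
  qed
  show ?case
  proof (cases "l \<in> D")
    case True
    define s2 where "s2 = s1(''d'' := (s1 ''d'')(l := 0))"
    have "D \<inter> {..<Suc l} - {l} = D \<inter> {..<l}" by auto
    then have s2: "repr (D \<inter> {..<l}) s2" "s2 ''i'' 0 = l" "s2 ''g'' 0 = 0"
      using repr_set_d(2)[OF s1(1) l(1)] s1 unfolding s2_def by auto
    have "run B (Assign ''d'' (scalar ''i'') (Const 0)) 1 s1 s2"
      using run_Assign[of s1 "''d''" "scalar ''i''" "Const 0" B] repr_B[OF s2(1)] s1(2) unfolding s2_def by simp
    then have "run B ?i (Suc 1) s1 s2"
      using True s1 repr_B[OF s1(1)] by (intro run_If) (auto simp: repr_def)
    from run_Seq[OF run1 this] have "run B ?c (?T + 16) s s2" by (rule run_mono) simp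
    then show ?thesis by (rule continue) (use s2 True in auto)
  next
    case False
    let ?S = "insert l (D \<inter> {..<l})"
    define s2 where "s2 = s1(''d'' := (s1 ''d'')(l := 1))"
    have eq: "D \<inter> {..<Suc l} = D \<inter> {..<l}" using False by (auto simp: less_Suc_eq)
    then have s2: "repr ?S s2" "s2 ''i'' 0 = l" "s2 ''g'' 0 = 0"
      using repr_set_d(1)[OF s1(1) l(1)] s1 unfolding s2_def by auto
    have run2: "run B (Assign ''d'' (scalar ''i'') (Const 1)) 1 s1 s2"
      using run_Assign[of s1 "''d''" "scalar ''i''" "Const 1" B] repr_B[OF s2(1)] s1(2) unfolding s2_def by simp
    obtain s3 where s3: "run B check (?T + 11) s2 s3" "repr ?S s3" "s3 ''i'' 0 = l" "s3 ''g'' 0 = 0"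
      "s3 ''b'' 0 = 0 \<longleftrightarrow> ?S \<in> privileged E"
      using run_check[OF s2(1)] s2(2,3) by auto
    have run_c: "run B ?c (?T + 16) s t" if "run B ?i2 2 s3 t" for t
    proof -
      have "run B ?i (Suc (1 + ((?T + 11) + 2))) s1 t"
        using False s1 repr_B[OF s1(1)] run_Seq[OF run2 run_Seq[OF s3(1) that]]
        by (intro run_If) (auto simp: repr_def)
      from run_Seq[OF run1 this] show ?thesis by (rule run_mono) simp
    qed
    show ?thesis
    proof (cases "?S \<in> privileged E")
      case True
      define s4 where "s4 = set_scalar ''g'' 1 s3"
      have s4: "repr ?S s4" "s4 ''g'' 0 = 1"
        using repr_set_scalar[OF s3(2)] b unfolding s4_def by auto
      have "run B (Assign ''g'' (Const 0) (Const 1)) 1 s3 s4"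
        using run_Assign[of s3 "''g''" "Const 0" "Const 1" B] repr_B[OF s4(1)] unfolding s4_def by simp
      then have "run B ?i2 (Suc 1) s3 s4"
        using True s3 repr_B[OF s3(2)] by (intro run_If) auto
      then have "run B ?c (?T + 16) s s4" by (intro run_c) (simp add: numeral_2_eq_2)
      moreover have "run B advance 1 s4 s4"
        unfolding advance_def by (intro run_WhileFalse) (use s4 repr_B in auto)
      ultimately have "run B advance (Suc (?T + 16) + 1) s s4"
        unfolding advance_def by (intro run_WhileTrue s)
      then have "run B advance (Suc l * (?T + 17) + 1) s s4" by (rule run_mono) simp
      then show ?thesis using s4 l(1) False True Suc.prems(5) by blast
    next
      case no: False
      define s4 where "s4 = s3(''d'' := (s3 ''d'')(l := 0))"
      have "?S - {l} = D \<inter> {..<l}" by auto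
      then have s4: "repr (D \<inter> {..<l}) s4" "s4 ''i'' 0 = l" "s4 ''g'' 0 = 0"
        using repr_set_d(2)[OF s3(2) l(1)] s3(3,4) unfolding s4_def by auto
      have "run B (Assign ''d'' (scalar ''i'') (Const 0)) 1 s3 s4"
        using run_Assign[of s3 "''d''" "scalar ''i''" "Const 0" B] repr_B[OF s4(1)] s3(3) unfolding s4_def by simp
      then have "run B ?i2 (Suc 1) s3 s4"
        using no s3 repr_B[OF s3(2)] by (intro run_If) auto
      then have "run B ?c (?T + 16) s s4" by (intro run_c) (simp add: numeral_2_eq_2)
      then show ?thesis by (rule continue) (use s4 no in auto)
    qed
  qed
qed

definition family :: "nat set set" where
  "family = Pow {..<n} \<inter> privileged E"

text \<open>These are the solutions still to come; their number is the measure of the induction over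
  the main loop.\<close>

definition later :: "nat set \<Rightarrow> nat set set" where
  "later D = {D' \<in> family. lex_less D D'}"

lemma finite_later: "finite (later D)"
  unfolding later_def family_def by simp

lemma later_no_successor:
  assumes "no_successor D 0"
  shows "later D = {}"
proof -
  have False if D': "D' \<subseteq> {..<n}" "D' \<in> privileged E" "lex_less D D'" for D'
  proof -
    obtain j where j: "j \<in> D'" "j \<notin> D" "D' \<inter> {..<j} = D \<inter> {..<j}"
      using D'(3) unfolding lex_less_def by blast
    then have "insert j (D \<inter> {..<j}) \<subseteq> D'" by (metis Int_lower1 insert_subset)
    from privileged_subset[OF D'(2) this] show False using assms j D'(1) unfolding no_successor_def by auto
  qed
  then show ?thesis unfolding later_def family_def by blast
qed

lemma later_successor:
  assumes D: "D \<subseteq> {..<n}" and l: "l < n" "l \<notin> D" "insert l (D \<inter> {..<l}) \<in> privileged E" "no_successor D (Suc l)"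
  shows "later D = insert (insert l (D \<inter> {..<l})) (later (insert l (D \<inter> {..<l})))"
    and "insert l (D \<inter> {..<l}) \<in> family"
proof -
  show S: "insert l (D \<inter> {..<l}) \<in> family" using D l unfolding family_def by auto
  have "lex_less D D' \<longleftrightarrow> D' = insert l (D \<inter> {..<l}) \<or> lex_less (insert l (D \<inter> {..<l})) D'"
    if "D' \<in> family" for D'
  proof (rule lex_less_successor[OF l(2)])
    show "insert k (D \<inter> {..<k}) \<notin> family" if "l < k" "k \<notin> D" for k
      using that l(4) unfolding no_successor_def family_def by auto
    show "A' \<in> family" if "A \<in> family" "A' \<subseteq> A" for A A'
      using that privileged_subset unfolding family_def by blast
  qed (rule that)
  then show "later D = insert (insert l (D \<inter> {..<l})) (later (insert l (D \<inter> {..<l})))"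
    using S unfolding later_def by blast
qed

text \<open>The longest wait between outputs consists of the previous search with its preparation
  (the product plus 3), the loop test, \<open>6 * n + 4 * length es + 6\<close> steps for writing,
  \<open>n\<close> steps for the numbers, and one for completion.\<close>

definition delay :: nat where
  "delay = n * (9 * n + 8 * length es + 17) + 7 * n + 4 * length es + 11"

abbreviation out_list :: "nat set \<Rightarrow> nat list" where
  "out_list D \<equiv> map (out D) [0..<n]"

lemma run_enum_body:
  assumes "D \<in> family" "repr D s"
  shows "\<exists>tr1 s1 tr2 t. exec enum_body s (tr1 @ (replicate n (None, s1) @ [(Some (out_list D), s1)]) @ tr2) t \<and>
    s1 \<in> B \<and> (\<forall>(out, s') \<in> set tr1. out = None \<and> s' \<in> B) \<and>
    (\<forall>(out, s') \<in> set tr2. out = None \<and> s' \<in> B) \<and> length tr1 \<le> 6 * n + 4 * length es + 6 \<and>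
    length tr2 \<le> n * (9 * n + 8 * length es + 17) + 3 \<and>
    (t \<in> B \<and> t ''g'' 0 = 0 \<and> later D = {} \<or>
     t ''g'' 0 = 1 \<and> (\<exists>D' \<in> family. repr D' t \<and> later D = insert D' (later D')))"
proof -
  have D: "D \<subseteq> {..<n}" using assms(1) unfolding family_def by simp
  obtain s1 where s1: "run B write_rdf (6 * n + 4 * length es + 6) s s1" "repr D s1" "\<forall>v<n. s1 ''f'' v = out D v"
    using run_write_rdf[OF assms(2)] by blast
  have n1: "s1 ''n'' 0 = n" using s1(2) unfolding repr_def by (auto simp: input_scalar)
  have "exec (Output ''f'' (scalar ''n'')) s1 (replicate (aval (scalar ''n'') s1) (None, s1) @
      [(Some (map (s1 ''f'') [0..<aval (scalar ''n'') s1]), s1)]) s1"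
    by (rule exec.Output)
  moreover have "map (s1 ''f'') [0..<n] = out_list D" using s1(3) by simp
  ultimately have exec_out: "exec (Output ''f'' (scalar ''n'')) s1 (replicate n (None, s1) @ [(Some (out_list D), s1)]) s1"
    using n1 by simp
  define s2 where "s2 = set_scalar ''g'' 0 s1"
  have s2: "repr D s2" "s2 ''n'' 0 = n" using repr_set_scalar[OF s1(2)] n1 unfolding s2_def by auto
  have run2: "run B (Assign ''g'' (Const 0) (Const 0)) 1 s1 s2"
    using run_Assign[of s1 "''g''" "Const 0" "Const 0" B] repr_B[OF s2(1)] unfolding s2_def by simp
  define s3 where "s3 = set_scalar ''i'' n s2"
  have s3: "repr D s3" "s3 ''i'' 0 = n" "s3 ''g'' 0 = 0"
    using repr_set_scalar[OF s2(1), of "''i''" n] b unfolding s3_def by (auto simp: s2_def)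
  have run3: "run B (Assign ''i'' (Const 0) (scalar ''n'')) 1 s2 s3"
    using run_Assign[of s2 "''i''" "Const 0" "scalar ''n''" B] repr_B[OF s3(1)] s2(2) unfolding s3_def by simp
  have "D \<inter> {..<n} = D" using D by blast
  moreover have "no_successor D n" unfolding no_successor_def by simp
  ultimately obtain t where t: "run B advance (n * (9 * n + 8 * length es + 17) + 1) s3 t"
    and t': "t ''g'' 0 = 0 \<and> t \<in> B \<and> no_successor D 0 \<or>
     t ''g'' 0 = 1 \<and> (\<exists>l<n. l \<notin> D \<and> insert l (D \<inter> {..<l}) \<in> privileged E \<and> no_successor D (Suc l) \<and>
       repr (insert l (D \<inter> {..<l})) t)"
    using run_advance[of D n s3] s3 by auto
  obtain tr1 where tr1: "exec write_rdf s tr1 s1" "length tr1 \<le> 6 * n + 4 * length es + 6"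
    "\<forall>(out, s') \<in> set tr1. out = None \<and> s' \<in> B"
    using s1(1) unfolding run_def by blast
  obtain tr2 where tr2: "exec (Seq (Assign ''g'' (Const 0) (Const 0)) (Seq (Assign ''i'' (Const 0) (scalar ''n'')) advance)) s1 tr2 t"
    "length tr2 \<le> 1 + (1 + (n * (9 * n + 8 * length es + 17) + 1))" "\<forall>(out, s') \<in> set tr2. out = None \<and> s' \<in> B"
    using run_Seq[OF run2 run_Seq[OF run3 t]] unfolding run_def by blast
  have "exec enum_body s (tr1 @ (replicate n (None, s1) @ [(Some (out_list D), s1)]) @ tr2) t"
    unfolding enum_body_def by (rule exec.Seq[OF tr1(1) exec.Seq[OF exec_out tr2(1)]])
  moreover have "t \<in> B \<and> t ''g'' 0 = 0 \<and> later D = {} \<or>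
     t ''g'' 0 = 1 \<and> (\<exists>D' \<in> family. repr D' t \<and> later D = insert D' (later D'))"
    using t' later_no_successor later_successor[OF D] by meson
  ultimately show ?thesis
    using tr1(2,3) tr2(2,3) repr_B[OF s1(2)]
    by (intro exI[of _ tr1] exI[of _ s1] exI[of _ tr2] exI[of _ t] conjI) simp_all
qed

text \<open>The search of a round belongs to the waiting time of the next output. Hence the delay is
  bounded for every number \<open>k\<close> of steps that such a search may have left over.\<close>

lemma run_enum_loop:
  assumes "D \<in> family" "repr D s" "s ''g'' 0 = 1"
  shows "\<exists>tr t ds. exec (While (Eq (scalar ''g'') (Const 1)) enum_body) s tr t \<and>
    snd ` set tr \<subseteq> B \<and> outputs tr = map out_list ds \<and> distinct ds \<and> set ds = insert D (later D) \<and>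
    (\<forall>k \<le> n * (9 * n + 8 * length es + 17) + 3. \<forall>w \<in> set (waiting_times k tr). w \<le> delay)"
  using assms
proof (induction "card (later D)" arbitrary: D s rule: less_induct)
  case less
  let ?K = "n * (9 * n + 8 * length es + 17) + 3"
  obtain tr1 s1 tr2 t where
    ex: "exec enum_body s (tr1 @ (replicate n (None, s1) @ [(Some (out_list D), s1)]) @ tr2) t"
    and tr: "s1 \<in> B" "\<forall>(out, s') \<in> set tr1. out = None \<and> s' \<in> B" "\<forall>(out, s') \<in> set tr2. out = None \<and> s' \<in> B"
      "length tr1 \<le> 6 * n + 4 * length es + 6" "length tr2 \<le> ?K"
    and t: "t \<in> B \<and> t ''g'' 0 = 0 \<and> later D = {} \<or>
     t ''g'' 0 = 1 \<and> (\<exists>D' \<in> family. repr D' t \<and> later D = insert D' (later D'))"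
    using run_enum_body[OF less.prems(1,2)] by (elim exE conjE) (rule that)
  let ?loop = "While (Eq (scalar ''g'') (Const 1)) enum_body"
  obtain tr3 u ds where tr3: "exec ?loop t tr3 u" "snd ` set tr3 \<subseteq> B" "outputs tr3 = map out_list ds"
    "distinct (D # ds)" "set ds = later D" "\<forall>k \<le> ?K. \<forall>w \<in> set (waiting_times k tr3). w \<le> delay"
    using t
  proof (elim disjE conjE bexE)
    assume "t \<in> B" "t ''g'' 0 = 0" "later D = {}"
    then show thesis
      by (intro that[of "[(None, t)]" t "[]"]) (auto intro: exec.WhileFalse simp: delay_def)
  next
    fix D' assume D': "t ''g'' 0 = 1" "D' \<in> family" "repr D' t" "later D = insert D' (later D')"
    have "D' \<notin> later D'" "D \<notin> later D" using lex_less_irrefl unfolding later_def by auto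
    then have "card (later D') < card (later D)" using D'(4) finite_later by simp
    from less.hyps[OF this D'(2,3,1)] show thesis using that D'(4) \<open>D \<notin> later D\<close> by auto
  qed
  let ?out = "replicate n (None, s1) @ [(Some (out_list D), s1)]"
  let ?tr = "(None, s) # (tr1 @ ?out @ tr2) @ tr3"
  have "exec ?loop s ?tr u"
    by (rule exec.WhileTrue[OF _ ex tr3(1)]) (simp add: less.prems(3))
  moreover have "snd ` set ?tr \<subseteq> B"
    using tr(1-3) tr3(2) repr_B[OF less.prems(2)] by auto
  moreover have silent: "\<forall>(out, s') \<in> set tr1. out = None" "\<forall>(out, s') \<in> set tr2. out = None"
    "\<forall>(out, s') \<in> set (replicate n (None, s1)). out = None"
    using tr(2,3) by auto
  have "outputs ?tr = map out_list (D # ds)"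
    using silent by (simp add: outputs_silent tr3(3))
  moreover have "waiting_times k ?tr = Suc (Suc k + length tr1 + n) # waiting_times (length tr2) tr3" for k
    using silent by (simp add: waiting_times_silent)
  then have "\<forall>k \<le> ?K. \<forall>w \<in> set (waiting_times k ?tr). w \<le> delay"
    using tr(4,5) tr3(6) unfolding delay_def by auto
  ultimately show ?case
    using tr3(4,5) by (intro exI[of _ ?tr] exI[of _ u] exI[of _ "D # ds"] conjI) auto
qed

end

context edge_list
begin

lemma input_state_repr: "repr {} (input_state n es)"
proof -
  let ?s = "input_state n es"
  have "x \<in> array_names \<and> i \<le> b \<and> ?s x i \<le> b" if "?s x i \<noteq> 0" for x i
    using that b edge_verts[of i] unfolding input_state_def array_names_def by (auto split: if_splits)
  then have "input ?s" unfolding input_def B_def capped_def by (auto simp: input_state_def)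
  then show ?thesis unfolding repr_def by (simp add: input_state_def)
qed

lemma family_eq: "family = insert {} (later {})"
  using lex_less_empty unfolding later_def family_def privileged_def by auto

lemma run_enum_rdfs:
  "\<exists>tr t ds. exec enum_rdfs (input_state n es) tr t \<and> snd ` set tr \<subseteq> B \<and> outputs tr = map out_list ds \<and>
     distinct ds \<and> set ds = family \<and> (\<forall>w \<in> set (waiting_times 0 tr). w \<le> delay)"
proof -
  define s where "s = set_scalar ''g'' 1 (input_state n es)"
  have s: "repr {} s" using repr_set_scalar[OF input_state_repr] b unfolding s_def by simp
  have init: "exec (Assign ''g'' (Const 0) (Const 1)) (input_state n es) [(None, s)] s"
    by (rule exec.Assign) (simp add: s_def)
  have "{} \<in> family" unfolding family_def privileged_def by simp
  then obtain tr t ds where loop: "exec (While (Eq (scalar ''g'') (Const 1)) enum_body) s tr t"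
    and tr: "snd ` set tr \<subseteq> B" "outputs tr = map out_list ds" "distinct ds" "set ds = family"
      "\<forall>k \<le> n * (9 * n + 8 * length es + 17) + 3. \<forall>w \<in> set (waiting_times k tr). w \<le> delay"
    using run_enum_loop[OF _ s] unfolding family_eq by (auto simp: s_def)
  have "exec enum_rdfs (input_state n es) ([(None, s)] @ tr) t"
    unfolding enum_rdfs_def by (rule exec.Seq[OF init loop])
  moreover have "\<forall>w \<in> set (waiting_times 0 ([(None, s)] @ tr)). w \<le> delay"
    using tr(5)[rule_format, of "Suc 0"] by auto
  ultimately show ?thesis
    using tr(1-4) repr_B[OF s] by (intro exI[of _ "[(None, s)] @ tr"] exI[of _ t] exI[of _ ds]) auto
qed

lemma inj_on_out_list: "inj_on out_list family"
proof (rule inj_onI)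
  fix D D' assume *: "D \<in> family" "D' \<in> family" "out_list D = out_list D'"
  have "{v \<in> {..<n}. out A v = 2} = A" if "A \<in> family" for A
    using that unfolding family_def out_def by auto
  moreover have "{v \<in> {..<n}. out D v = 2} = {v \<in> {..<n}. out D' v = 2}" using *(3) by auto
  ultimately show "D = D'" using *(1,2) by simp
qed

text \<open>The factor 2 absorbs the wait after the last output, as
  \<open>1 \<le> sqrt 3 ^ n\<close>. The factor 24 is 2 times the 12 array names.\<close>

lemma enumerates_family:
  assumes "real (card family) \<le> sqrt 3 ^ n" "2 * delay \<le> P" "24 * Suc b * Suc b \<le> P"
  shows "enumerates_within enum_rdfs (input_state n es) (out_list ` family) (real P * sqrt 3 ^ n) P P"
proof -
  obtain tr t ds where tr: "exec enum_rdfs (input_state n es) tr t" "snd ` set tr \<subseteq> B" "outputs tr = map out_list ds"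
    "distinct ds" "set ds = family" "\<forall>w \<in> set (waiting_times 0 tr). w \<le> delay"
    using run_enum_rdfs by blast
  have "length ds = card family" using tr(4,5) distinct_card by metis
  then have "length tr \<le> Suc (card family) * delay" using length_trace_le[OF tr(6)] tr(3) by simp
  then have "real (length tr) \<le> real (Suc (card family) * delay)" by (simp only: of_nat_le_iff)
  also have "\<dots> = (real (card family) + 1) * real delay" by (simp add: algebra_simps)
  also have "\<dots> \<le> (2 * sqrt 3 ^ n) * real delay"
  proof (rule mult_right_mono)
    have "1 \<le> sqrt 3 ^ n" by (rule one_le_power) simp
    then show "real (card family) + 1 \<le> 2 * sqrt 3 ^ n" using assms(1) by linarith
  qed simp
  also have "\<dots> = real (2 * delay) * sqrt 3 ^ n" by simp
  also have "\<dots> \<le> real P * sqrt 3 ^ n"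
    using assms(2) by (intro mult_right_mono) (simp_all flip: of_nat_le_iff)
  finally have "real (length tr) \<le> real P * sqrt 3 ^ n" .
  moreover have "space s' \<le> P" if "s' \<in> insert (input_state n es) (snd ` set tr)" for s'
  proof -
    have "s' \<in> capped array_names b" using that tr(2) repr_B[OF input_state_repr] unfolding B_def by auto
    then have "space s' \<le> card array_names * Suc b * (2 * Suc b)"
      by (rule space_capped) (simp add: array_names_def)
    also have "card array_names = 12" unfolding array_names_def by simp
    also have "12 * Suc b * (2 * Suc b) = 24 * Suc b * Suc b" by (simp only: mult_ac)
    finally show ?thesis using assms(3) by (rule order_trans)
  qed
  moreover have "distinct (outputs tr)" "set (outputs tr) = out_list ` family"
    using tr(3-5) inj_on_out_list by (auto simp: distinct_map)
  moreover have "\<forall>w \<in> set (waiting_times 0 tr). w \<le> P" using tr(6) assms(2) by fastforce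
  ultimately show ?thesis
    unfolding enumerates_within_def using tr(1) by (intro exI[of _ tr] exI[of _ t] conjI ballI) simp_all
qed

end

theorem minimal_rdfs_bound:
  assumes "undirected_forest G"
  shows "real (card (minimal_rdfs G)) \<le> sqrt 3 ^ card (pverts G)"
proof -
  note f = undirected_forest_rel[OF assms]
  have "sym (parcs G)" using f(3) unfolding forest_rel_def by blast
  then show ?thesis using card_minimal_rdfs[OF f(2)] forest_privileged_bound[OF f] by simp
qed

text \<open>With at most \<open>n * n\<close> edges, the first summand of \<open>P\<close> is twice
  the bound on \<open>delay\<close>. The second is the space bound for the cap
  \<open>n * n + n + 2\<close>, whose successor is the value of \<open>[:3, 1, 1:]\<close>.\<close>

theorem enum_rdfs_correct:
  defines "P \<equiv> [:22, 48, 26, 16:] + smult 24 ([:3, 1, 1:] * [:3, 1, 1:])"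
  assumes "undirected_forest G" "pverts G = {0..<n}" "edge_list_of G es"
  shows "enumerates_within enum_rdfs (input_state n es) (value_list n ` minimal_rdfs G)
    (real (poly P n) * sqrt 3 ^ n) (poly P n) (poly P n)"
proof -
  note f = undirected_forest_rel[OF assms(2)]
  have sym: "sym (parcs G)" using f(3) unfolding forest_rel_def by blast
  have V: "pverts G = {..<n}" unfolding assms(3) by (rule lessThan_atLeast0[symmetric])
  have es: "distinct es" "set es \<inter> (set es)\<inverse> = {}" "parcs G = set es \<union> (set es)\<inverse>"
    using assms(4) unfolding edge_list_of_def by - (elim conjE; assumption)+
  have "set es \<subseteq> parcs G" unfolding es(3) by (rule Un_upper1)
  then have "set es \<subseteq> {..<n} \<times> {..<n}" using f(2) unfolding V by (rule subset_trans)
  then have m: "length es \<le> n * n"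
    using card_mono[of "{..<n} \<times> {..<n}" "set es"] distinct_card[OF es(1)]
    by (simp add: card_cartesian_product)
  interpret edge_list n es "parcs G" "n * n + n + 2" "capped array_names (n * n + n + 2)"
  proof unfold_locales
    show "parcs G \<subseteq> {..<n} \<times> {..<n}" using f(2) unfolding V .
    show "n + 2 \<le> n * n + n + 2" "length es \<le> n * n + n + 2" using m by simp_all
  qed (rule es)+
  have "value_list n (rdf_of G D) = out_list D" if "D \<in> family" for D
    unfolding value_list_def rdf_of_def out_def V by simp
  moreover have "minimal_rdfs G = rdf_of G ` family"
    unfolding minimal_rdfs_eq[OF f(2) sym] family_def V ..
  ultimately have "value_list n ` minimal_rdfs G = out_list ` family"
    by (simp add: image_image)
  moreover have "real (card family) \<le> sqrt 3 ^ n"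
    using forest_privileged_bound[OF f] unfolding family_def V by simp
  moreover have "2 * delay \<le> poly P n"
  proof -
    have "delay \<le> n * (9 * n + 8 * (n * n) + 17) + 7 * n + 4 * (n * n) + 11"
      unfolding delay_def using m by (intro add_mono mult_mono) auto
    then show ?thesis unfolding P_def by (simp add: algebra_simps)
  qed
  moreover have "24 * Suc (n * n + n + 2) * Suc (n * n + n + 2) \<le> poly P n"
    unfolding P_def by (simp add: algebra_simps)
  ultimately show ?thesis using enumerates_family[of "poly P n"] by simp
qed

theorem theorem5:
  shows "(\<forall>G :: 'a pair_pre_digraph. undirected_forest G \<longrightarrow>
            real (card (minimal_rdfs G)) \<le> sqrt 3 ^ card (pverts G)) \<and>
         (\<exists>(P :: com) (p :: nat poly). \<forall>(n :: nat) (G :: nat pair_pre_digraph) es.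
            undirected_forest G \<and> pverts G = {0..<n} \<and> edge_list_of G es \<longrightarrow>
            enumerates_within P (input_state n es) (value_list n ` minimal_rdfs G)
              (real (poly p n) * sqrt 3 ^ n) (poly p n) (poly p n))"
proof (intro conjI exI allI impI)
  show "real (card (minimal_rdfs G)) \<le> sqrt 3 ^ card (pverts G)" if "undirected_forest G" for G :: "'a pair_pre_digraph"
    using that by (rule minimal_rdfs_bound)
qed (elim conjE, rule enum_rdfs_correct)

end
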